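(* Let $\alpha\in(0,1)$ and let $B$ be any permutation count. (i) If $\mathbb P=\mathbb Q$, then the cheap homogeneity test based on any quadratic test statistic rejects the null with probability exactly $\alpha$. (ii) If $\Pi=\mathbb P\times\mathbb Q$, then the cheap independence test based on any independence V-statistic rejects the null with probability exactly $\alpha$.
   Context: Homogeneity setting: $Y=(Y_i)_{i=1}^{n_1}$ i.i.d. from $\mathbb P$ and, independently, $Z=(Z_j)_{j=1}^{n_2}$ i.i.d. from $\mathbb Q$; null $\mathbb P=\mathbb Q$. With empirical distributions $\widehat{\mathbb P}=\frac1{n_1}\sum_i\delta_{Y_i}$, $\widehat{\mathbb Q}=\frac1{n_2}\sum_j\delta_{Z_j}$, a quadratic test statistic is $T(Y,Z)=(\widehat{\mathbb P}\times\widehat{\mathbb P})\phi_{n_1}+(\widehat{\mathbb P}\times\widehat{\mathbb Q})\phi_{n_1,n_2}+(\widehat{\mathbb Q}\times\widehat{\mathbb Q})\phi_{n_2}$ for base functions $\phi_{n_1},\phi_{n_2},\phi_{n_1,n_2}$, where $\mu f$ denotes the integral of $f$ against $\mu$. Cheap homogeneity test: let $n=n_1+n_2$ and $(X_i)_{i=1}^n=(Y_1,\dots,Y_{n_1},Z_1,\dots,Z_{n_2})$. Split $[n]=\{1,\dots,n\}$ into $s$ consecutive bins $\mathcal I_1,\dots,\mathcal I_s$ of equal size ($s$ divides $n$ and $s_1=s\,n_1/n$ is an integer). For a permutation $\pi$ of $[s]$ let $Y^\pi$ consist of the points in bins $\mathcal I_{\pi(1)},\dots,\mathcal I_{\pi(s_1)}$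 and $Z^\pi$ of those in bins $\mathcal I_{\pi(s_1+1)},\dots,\mathcal I_{\pi(s)}$. Draw $\pi_1,\dots,\pi_B$ i.i.d. uniform over permutations of $[s]$, independent of the data; $T_0=T(Y,Z)$, $T_b=T(Y^{\pi_b},Z^{\pi_b})$. Independence setting: $(Y_i,Z_i)_{i=1}^n$ i.i.d. from $\Pi$ with marginals $\mathbb P,\mathbb Q$; null $\Pi=\mathbb P\times\mathbb Q$. For symmetric real-valued $g_Y,g_Z$, the independence V-statistic is $V(Y,Z)=\frac1{n^4}\sum_{(i_1,\dots,i_4)\in[n]^4}\big(g_Y(Y_{i_1},Y_{i_2})+g_Y(Y_{i_3},Y_{i_4})-g_Y(Y_{i_1},Y_{i_3})-g_Y(Y_{i_2},Y_{i_4})\big)\big(g_Z(Z_{i_1},Z_{i_2})+g_Z(Z_{i_3},Z_{i_4})-g_Z(Z_{i_1},Z_{i_3})-g_Z(Z_{i_2},Z_{i_4})\big)$. Cheap independence test: $s$ is even and divides $n$; split $[n]$ into $s$ consecutive bins of equal size; for a permutation $\pi$ of $[s]$ let $Z^\pi$ be obtained from $Z$ by replacing its $i$-th bin of values by its $\pi(i)$-th bin, $i\in[s]$. A wild bootstrap permutation of $[s]$ swaps $i$ and $i+s/2$ with probability $\frac12$ independently for each $i\le s/2$. Draw $\pi_1,\dots,\pi_B$ i.i.d. wild bootstrap permutations of $[s]$, independent of the data; $T_0=V(Y,Z)$, $T_b=V(Y,Z^{\pi_b})$. In both cases let $R=1+$ the number of $b\in\{1,\dots,B\}$ with $T_b$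 smaller than $T_0$, with ties broken uniformly at random (so $R$ is the rank of $T_0$ among $T_0,\dots,T_B$); the test rejects the null with (conditional) probability $\Delta=\min(1,\max(0,R-(1-\alpha)(B+1)))$, so that its rejection probability is $\mathbb E[\Delta]$. *)

theory Defs
  imports "HOL-Probability.Probability" "HOL-Combinatorics.Permutations"
begin

text \<open>
  Indices start at 0: a sample of size \<open>n\<close> is a sequence restricted to \<open>{..<n}\<close>, and permutations
  of the \<open>s\<close> bins act on \<open>{..<s}\<close>.
\<close>

section \<open>Bins\<close>

definition bin :: "nat \<Rightarrow> nat \<Rightarrow> nat \<Rightarrow> nat set" where
  "bin n s k = {k * (n div s) ..< Suc k * (n div s)}"

text \<open>
  The sequence \<open>x \<circ> bin_map n s p\<close> has as its \<open>k\<close>-th bin the \<open>p k\<close>-th bin of \<open>x\<close>, with the order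
  inside each bin kept.
\<close>

definition bin_map :: "nat \<Rightarrow> nat \<Rightarrow> (nat \<Rightarrow> nat) \<Rightarrow> nat \<Rightarrow> nat" where
  "bin_map n s p i = p (i div (n div s)) * (n div s) + i mod (n div s)"

lemma bin_map_image_bin: "bin_map n s p ` bin n s k = bin n s (p k)"
proof (cases "n div s = 0")
  case True
  then show ?thesis by (simp add: bin_def)
next
  case False
  define m where "m = n div s"
  have m: "m > 0" using False by (simp add: m_def)
  have bin: "bin n s l = (\<lambda>r. l * m + r) ` {..<m}" for l
  proof -
    have "(\<lambda>r. l * m + r) ` {..<m} = (+) (l * m) ` {0..<m}"
      by (simp add: lessThan_atLeast0)
    also have "\<dots> = {l * m ..< l * m + m}"
      by (simp only: image_add_atLeastLessThan) (simp add: add.commute)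
    finally show ?thesis by (simp add: bin_def m_def add.commute)
  qed
  have "bin_map n s p (k * m + r) = p k * m + r" if "r < m" for r
    using that m by (simp add: bin_map_def flip: m_def)
  then show ?thesis by (simp add: bin image_image)
qed


section \<open>Rank and rejection\<close>

text \<open>
  \<open>T 0\<close> is the statistic on the original data, \<open>T 1, \<dots>, T B\<close> those on the permuted data.
  Ties are resolved by a ranking \<open>\<tau>\<close> of \<open>{..B}\<close>, which will be a uniformly random permutation.
\<close>

definition test_rank :: "nat \<Rightarrow> (nat \<Rightarrow> real) \<Rightarrow> (nat \<Rightarrow> nat) \<Rightarrow> nat" where
  "test_rank B T \<tau> = 1 + card {b \<in> {1..B}. T b < T 0 \<or> (T b = T 0 \<and> \<tau> b < \<tau> 0)}"

definition conditional_rejection :: "real \<Rightarrow> nat \<Rightarrow> nat \<Rightarrow> real" where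
  "conditional_rejection \<alpha> B R = min 1 (max 0 (real R - (1 - \<alpha>) * (real B + 1)))"

definition rejection_probability ::
    "'w measure \<Rightarrow> real \<Rightarrow> nat \<Rightarrow> (nat \<Rightarrow> 'w \<Rightarrow> real) \<Rightarrow> ('w \<Rightarrow> nat \<Rightarrow> nat) \<Rightarrow> real" where
  "rejection_probability M \<alpha> B T \<tau> =
     (\<integral>\<omega>. conditional_rejection \<alpha> B (test_rank B (\<lambda>b. T b \<omega>) (\<tau> \<omega>)) \<partial>M)"


section \<open>Random permutations and tie-breaking\<close>

text \<open>
  The library's \<open>indep_var\<close> needs both variables to have the same value type.
\<close>

definition (in prob_space) indep_pair ::
    "'b measure \<Rightarrow> ('a \<Rightarrow> 'b) \<Rightarrow> 'c measure \<Rightarrow> ('a \<Rightarrow> 'c) \<Rightarrow> bool" where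
  "indep_pair N U N' V \<longleftrightarrow>
     random_variable N U \<and> random_variable N' V \<and>
     indep_set {U -` A \<inter> space M | A. A \<in> sets N} {V -` A \<inter> space M | A. A \<in> sets N'}"

text \<open>
  \<open>D\<close> is the data, with values in the measurable space \<open>N\<close>. The draws are required to be
  permutations surely and not just almost surely: outside this event the permuted statistics
  would refer to points outside the sample, whose measurability is not assumed.
\<close>

locale permutation_draws = prob_space M
  for M :: "'w measure" +
  fixes N :: "'d measure" and D :: "'w \<Rightarrow> 'd"
    and law :: "(nat \<Rightarrow> nat) pmf" and s B :: nat
    and \<pi> :: "nat \<Rightarrow> 'w \<Rightarrow> nat \<Rightarrow> nat" and \<tau> :: "'w \<Rightarrow> nat \<Rightarrow> nat"
  assumes draws_permute: "\<And>b \<omega>. b \<in> {1..B} \<Longrightarrow> \<omega> \<in> space M \<Longrightarrow> \<pi> b \<omega> permutes {..<s}"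
    and draws_indep: "indep_vars (\<lambda>_. count_space UNIV) \<pi> {1..B}"
    and draws_law: "\<And>b. b \<in> {1..B} \<Longrightarrow> distr M (count_space UNIV) (\<pi> b) = measure_pmf law"
    and draws_indep_data:
      "indep_pair N D (Pi\<^sub>M {1..B} (\<lambda>_. count_space UNIV)) (\<lambda>\<omega>. \<lambda>b\<in>{1..B}. \<pi> b \<omega>)"
    and ties_law:
      "distr M (count_space UNIV) \<tau> = measure_pmf (pmf_of_set {t. t permutes {..B}})"
    and ties_indep:
      "indep_pair (N \<Otimes>\<^sub>M Pi\<^sub>M {1..B} (\<lambda>_. count_space UNIV)) (\<lambda>\<omega>. (D \<omega>, \<lambda>b\<in>{1..B}. \<pi> b \<omega>))
                  (count_space UNIV) \<tau>"


section \<open>Homogeneity testing\<close>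

definition empirical :: "nat \<Rightarrow> (nat \<Rightarrow> 'a) \<Rightarrow> 'a pmf" where
  "empirical n x = map_pmf x (pmf_of_set {..<n})"

definition quadratic_statistic ::
    "('a \<times> 'a \<Rightarrow> real) \<Rightarrow> ('a \<times> 'a \<Rightarrow> real) \<Rightarrow> ('a \<times> 'a \<Rightarrow> real) \<Rightarrow> nat \<Rightarrow> nat \<Rightarrow>
     (nat \<Rightarrow> 'a) \<Rightarrow> (nat \<Rightarrow> 'a) \<Rightarrow> real" where
  "quadratic_statistic \<phi>1 \<phi>12 \<phi>2 n1 n2 y z =
     measure_pmf.expectation (pair_pmf (empirical n1 y) (empirical n1 y)) \<phi>1 +
     measure_pmf.expectation (pair_pmf (empirical n1 y) (empirical n2 z)) \<phi>12 +
     measure_pmf.expectation (pair_pmf (empirical n2 z) (empirical n2 z)) \<phi>2"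

definition pooled :: "nat \<Rightarrow> (nat \<Rightarrow> 'a) \<Rightarrow> (nat \<Rightarrow> 'a) \<Rightarrow> nat \<Rightarrow> 'a" where
  "pooled n1 y z i = (if i < n1 then y i else z (i - n1))"

locale cheap_homogeneity_test = prob_space M
  + permutation_draws M
      "Pi\<^sub>M {..<n1 + n2} (\<lambda>_. P)" "\<lambda>\<omega>. \<lambda>i\<in>{..<n1 + n2}. pooled n1 Y Z i \<omega>"
      "pmf_of_set {p. p permutes {..<s}}" s B \<pi> \<tau>
  for M :: "'w measure" and P Q :: "'a measure" and n1 n2 :: nat
    and Y Z :: "nat \<Rightarrow> 'w \<Rightarrow> 'a" and s B :: nat
    and \<pi> :: "nat \<Rightarrow> 'w \<Rightarrow> nat \<Rightarrow> nat" and \<tau> :: "'w \<Rightarrow> nat \<Rightarrow> nat" +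
  assumes sizes: "0 < n1" "0 < n2"
    and prob_P: "prob_space P" and prob_Q: "prob_space Q" and sets_Q: "sets Q = sets P"
    and data_indep: "indep_vars (\<lambda>_. P) (pooled n1 Y Z) {..<n1 + n2}"
    and law_Y: "\<And>i. i < n1 \<Longrightarrow> distr M P (Y i) = P"
    and law_Z: "\<And>j. j < n2 \<Longrightarrow> distr M Q (Z j) = Q"
    and bins: "s dvd n1 + n2" "n1 + n2 dvd s * n1"

text \<open>
  Since \<open>n1\<close> is \<open>s1\<close> times the bin size, the first \<open>n1\<close> entries of the pooled sample
  rearranged by \<open>p\<close> form the bins \<open>p 0, \<dots>, p (s1 - 1)\<close>, and the remaining \<open>n2\<close> entries the other bins.
\<close>

definition homogeneity_statistics ::
    "((nat \<Rightarrow> 'a) \<Rightarrow> (nat \<Rightarrow> 'a) \<Rightarrow> real) \<Rightarrow> nat \<Rightarrow> nat \<Rightarrow> nat \<Rightarrow>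
     (nat \<Rightarrow> 'w \<Rightarrow> 'a) \<Rightarrow> (nat \<Rightarrow> 'w \<Rightarrow> 'a) \<Rightarrow> (nat \<Rightarrow> 'w \<Rightarrow> nat \<Rightarrow> nat) \<Rightarrow> nat \<Rightarrow> 'w \<Rightarrow> real" where
  "homogeneity_statistics T n1 n2 s Y Z \<pi> b \<omega> =
     (if b = 0 then T (\<lambda>i. Y i \<omega>) (\<lambda>j. Z j \<omega>)
      else let x = (\<lambda>i. pooled n1 Y Z (bin_map (n1 + n2) s (\<pi> b \<omega>) i) \<omega>)
           in T x (\<lambda>j. x (n1 + j)))"


section \<open>Independence testing\<close>

definition independence_V_statistic ::
    "('a \<Rightarrow> 'a \<Rightarrow> real) \<Rightarrow> ('b \<Rightarrow> 'b \<Rightarrow> real) \<Rightarrow> nat \<Rightarrow> (nat \<Rightarrow> 'a) \<Rightarrow> (nat \<Rightarrow> 'b) \<Rightarrow> real" where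
  "independence_V_statistic gY gZ n y z =
     1 / real n ^ 4 *
     (\<Sum>(i1, i2, i3, i4) \<in> {..<n} \<times> {..<n} \<times> {..<n} \<times> {..<n}.
        (gY (y i1) (y i2) + gY (y i3) (y i4) - gY (y i1) (y i3) - gY (y i2) (y i4)) *
        (gZ (z i1) (z i2) + gZ (z i3) (z i4) - gZ (z i1) (z i3) - gZ (z i2) (z i4)))"

definition wild_swap :: "nat \<Rightarrow> (nat \<Rightarrow> bool) \<Rightarrow> nat \<Rightarrow> nat" where
  "wild_swap s c i =
     (if i < s div 2 \<and> c i then i + s div 2
      else if s div 2 \<le> i \<and> i < s \<and> c (i - s div 2) then i - s div 2
      else i)"

definition wild_bootstrap_pmf :: "nat \<Rightarrow> (nat \<Rightarrow> nat) pmf" where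
  "wild_bootstrap_pmf s =
     map_pmf (wild_swap s) (Pi_pmf {..<s div 2} False (\<lambda>_. bernoulli_pmf (1 / 2)))"

locale cheap_independence_test = prob_space M
  + permutation_draws M
      "Pi\<^sub>M {..<n} (\<lambda>_. J)" "\<lambda>\<omega>. \<lambda>i\<in>{..<n}. (Y i \<omega>, Z i \<omega>)"
      "wild_bootstrap_pmf s" s B \<pi> \<tau>
  for M :: "'w measure" and J :: "('a \<times> 'b) measure" and P :: "'a measure" and Q :: "'b measure"
    and n :: nat and Y :: "nat \<Rightarrow> 'w \<Rightarrow> 'a" and Z :: "nat \<Rightarrow> 'w \<Rightarrow> 'b" and s B :: nat
    and \<pi> :: "nat \<Rightarrow> 'w \<Rightarrow> nat \<Rightarrow> nat" and \<tau> :: "'w \<Rightarrow> nat \<Rightarrow> nat" +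
  assumes size: "0 < n"
    and prob_J: "prob_space J" and sets_J: "sets J = sets (P \<Otimes>\<^sub>M Q)"
    and marginals: "distr J P fst = P" "distr J Q snd = Q"
    and data_indep: "indep_vars (\<lambda>_. J) (\<lambda>i \<omega>. (Y i \<omega>, Z i \<omega>)) {..<n}"
    and data_law: "\<And>i. i < n \<Longrightarrow> distr M J (\<lambda>\<omega>. (Y i \<omega>, Z i \<omega>)) = J"
    and bins: "even s" "s dvd n"

definition independence_statistics ::
    "((nat \<Rightarrow> 'a) \<Rightarrow> (nat \<Rightarrow> 'b) \<Rightarrow> real) \<Rightarrow> nat \<Rightarrow> nat \<Rightarrow>
     (nat \<Rightarrow> 'w \<Rightarrow> 'a) \<Rightarrow> (nat \<Rightarrow> 'w \<Rightarrow> 'b) \<Rightarrow> (nat \<Rightarrow> 'w \<Rightarrow> nat \<Rightarrow> nat) \<Rightarrow> nat \<Rightarrow> 'w \<Rightarrow> real" where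
  "independence_statistics V n s Y Z \<pi> b \<omega> =
     (if b = 0 then V (\<lambda>i. Y i \<omega>) (\<lambda>i. Z i \<omega>)
      else V (\<lambda>i. Y i \<omega>) (\<lambda>i. Z (bin_map n s (\<pi> b \<omega>) i) \<omega>))"

end

theory Submission
  imports Defs
begin

text \<open>
  The permutations that the tests draw form a finite group \<open>G\<close>, and the statistics are values
  \<open>F d p\<close> of the data \<open>d\<close> and a permutation \<open>p\<close>, with \<open>p = id\<close> for the original statistic. An element
  \<open>g\<close> of \<open>G\<close> also acts on the data, by rearranging the bins, and \<open>F (g d) p = F d (g \<circ> p)\<close>. Under the
  null hypothesis this action preserves the law of the data: it permutes i.i.d. entries of the pooled
  sample, respectively the \<open>Z\<close> entries, which are i.i.d. and independent of the \<open>Y\<close> entries.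

  Replacing the data by \<open>g d\<close> for a uniformly random \<open>g\<close> therefore leaves the rejection probability
  unchanged, and turns the permutations \<open>id, \<pi> 1, \<dots>, \<pi> B\<close> into \<open>g, g \<circ> \<pi> 1, \<dots>, g \<circ> \<pi> B\<close>. These are
  \<open>B + 1\<close> independent uniform elements of \<open>G\<close>, as left translation by \<open>g\<close> is a bijection of \<open>G\<close>
  (\<open>sum_translates\<close>). For every fixed value of the data, the \<open>B + 1\<close> statistics are now exchangeable,
  and with random tie-breaking the rank of each of them is uniform on \<open>{1..B + 1}\<close>. The conditional
  rejection probability averages to \<open>\<alpha>\<close> over this range: its values are \<open>0\<close> up to the threshold
  \<open>(1 - \<alpha>) (B + 1)\<close>, a fractional part at the threshold and \<open>1\<close> beyond it, with total \<open>\<alpha> (B + 1)\<close>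
  (\<open>sum_rejection_exchangeable\<close>).

  The draws and the tie-breaking ranking take finitely many values almost surely, so their
  independence from the data is used in the form of finite sums of integrals over the data
  (\<open>expectation_indep_pair_finite\<close>). The resulting principle for a group acting on the data is
  \<open>rejection_probability_eq_level\<close>, and both tests are instances of it.
\<close>

section \<open>Ranks of exchangeable statistics\<close>

text \<open>
  In a finite strict total order, an element that precedes another one has strictly fewer
  predecessors, so ranks are distinct and fill \<open>{1..card A}\<close>.
\<close>

lemma card_predecessors_bij_betw:
  assumes fin: "finite A"
    and irrefl: "\<And>i. i \<in> A \<Longrightarrow> \<not> r i i"
    and trans: "\<And>i j k. i \<in> A \<Longrightarrow> j \<in> A \<Longrightarrow> k \<in> A \<Longrightarrow> r i j \<Longrightarrow> r j k \<Longrightarrow> r i k"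
    and total: "\<And>i j. i \<in> A \<Longrightarrow> j \<in> A \<Longrightarrow> i \<noteq> j \<Longrightarrow> r i j \<or> r j i"
  shows "bij_betw (\<lambda>i. Suc (card {b \<in> A. r b i})) A {1..card A}"
proof -
  let ?f = "\<lambda>i. Suc (card {b \<in> A. r b i})"
  have less: "card {b \<in> A. r b i} < card {b \<in> A. r b j}" if "i \<in> A" "j \<in> A" "r i j" for i j
  proof (rule psubset_card_mono)
    show "{b \<in> A. r b i} \<subset> {b \<in> A. r b j}"
      using that irrefl trans by blast
  qed (use fin in auto)
  have inj: "inj_on ?f A"
  proof (rule inj_onI)
    fix i j assume ij: "i \<in> A" "j \<in> A" "?f i = ?f j"
    show "i = j"
    proof (rule ccontr)
      assume "i \<noteq> j"
      with total[OF ij(1,2)] less[OF ij(1,2)] less[OF ij(2,1)] ij(3) show False by auto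
    qed
  qed
  have "card {b \<in> A. r b i} < card A" if "i \<in> A" for i
    using that irrefl fin by (intro psubset_card_mono) auto
  then have "?f ` A \<subseteq> {1..card A}"
    by (auto simp: Suc_le_eq)
  then have "?f ` A = {1..card A}"
    by (rule card_subset_eq[rotated]) (simp_all add: card_image[OF inj])
  with inj show ?thesis
    by (simp add: bij_betw_def)
qed

text \<open>
  The test only ranks \<open>T 0\<close>. The averaging argument compares this rank with the ranks of the other
  statistics under the same tie-breaking.
\<close>

definition rank_at :: "nat \<Rightarrow> nat \<Rightarrow> (nat \<Rightarrow> real) \<Rightarrow> (nat \<Rightarrow> nat) \<Rightarrow> nat" where
  "rank_at i B T t = Suc (card {b \<in> {..B}. T b < T i \<or> (T b = T i \<and> t b < t i)})"

lemma test_rank_eq_rank_at_0: "test_rank B T t = rank_at 0 B T t"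
proof -
  have "{b \<in> {1..B}. T b < T 0 \<or> (T b = T 0 \<and> t b < t 0)}
      = {b \<in> {..B}. T b < T 0 \<or> (T b = T 0 \<and> t b < t 0)}"
    by (auto simp: Suc_le_eq) (metis less_irrefl neq0_conv)+
  then show ?thesis by (simp add: test_rank_def rank_at_def)
qed

lemma rank_at_permute:
  assumes "\<sigma> permutes {..B}"
  shows "rank_at i B (\<lambda>b. T (\<sigma> b)) (\<lambda>b. t (\<sigma> b)) = rank_at (\<sigma> i) B T t"
proof -
  have "\<sigma> ` {b \<in> {..B}. T (\<sigma> b) < T (\<sigma> i) \<or> (T (\<sigma> b) = T (\<sigma> i) \<and> t (\<sigma> b) < t (\<sigma> i))}
      = {b \<in> {..B}. T b < T (\<sigma> i) \<or> (T b = T (\<sigma> i) \<and> t b < t (\<sigma> i))}" (is "\<sigma> ` ?X = ?Y")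
  proof
    show "?Y \<subseteq> \<sigma> ` ?X"
    proof
      fix b assume b: "b \<in> ?Y"
      then have "b \<in> \<sigma> ` {..B}"
        using permutes_image[OF assms] by simp
      then obtain c where "c \<in> {..B}" "b = \<sigma> c" by blast
      with b show "b \<in> \<sigma> ` ?X" by blast
    qed
  qed (use permutes_in_image[OF assms] in auto)
  moreover have "inj_on \<sigma> ?X"
    using permutes_inj_on[OF assms] .
  ultimately show ?thesis
    unfolding rank_at_def by (metis (no_types, lifting) card_image)
qed

lemma rank_at_bij_betw:
  assumes "inj_on t {..B}"
  shows "bij_betw (\<lambda>i. rank_at i B T t) {..B} {1..Suc B}"
proof -
  have "bij_betw (\<lambda>i. Suc (card {b \<in> {..B}. T b < T i \<or> (T b = T i \<and> t b < t i)})) {..B} {1..card {..B}}"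
  proof (rule card_predecessors_bij_betw)
    fix i j assume "i \<in> {..B}" "j \<in> {..B}" "i \<noteq> j"
    then have "t i \<noteq> t j" using assms by (auto dest: inj_onD)
    then show "(T i < T j \<or> T i = T j \<and> t i < t j) \<or> (T j < T i \<or> T j = T i \<and> t j < t i)"
      by linarith
  qed auto
  then show ?thesis by (simp add: rank_at_def)
qed

text \<open>
  The \<open>r\<close>-th summand is the length of the part of the interval from \<open>r - 1\<close> to \<open>r\<close> that lies
  above \<open>c\<close>.
\<close>

lemma sum_clamp:
  fixes c :: real
  assumes "0 \<le> c"
  shows "(\<Sum>r\<in>{1..n}. min 1 (max 0 (real r - c))) = max 0 (real n - c)"
proof (induction n)
  case 0
  then show ?case using assms by simp
next
  case (Suc n)
  have "(\<Sum>r\<in>{1..Suc n}. min 1 (max 0 (real r - c))) = max 0 (real n - c) + min 1 (max 0 (real (Suc n) - c))"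
    using Suc by simp
  also have "\<dots> = max 0 (real (Suc n) - c)" by simp
  finally show ?case .
qed

lemma sum_conditional_rejection:
  assumes "0 < \<alpha>" "\<alpha> < 1"
  shows "(\<Sum>r\<in>{1..Suc B}. conditional_rejection \<alpha> B r) = \<alpha> * (real B + 1)"
proof -
  have "0 \<le> \<alpha> * (real B + 1)"
    using assms by simp
  moreover have "real (Suc B) - (1 - \<alpha>) * (real B + 1) = \<alpha> * (real B + 1)"
    by (simp add: algebra_simps)
  ultimately show ?thesis
    unfolding conditional_rejection_def
    using assms by (subst sum_clamp) auto
qed

text \<open>
  Transposing \<open>0\<close> and \<open>i\<close> in both the tuple \<open>q\<close> and the ranking \<open>t\<close> is a bijection of the summation
  range that exchanges the ranks at \<open>0\<close> and at \<open>i\<close>. Hence the sum does not change when the rank at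
  \<open>0\<close> is replaced by the rank at \<open>i\<close>, and for fixed \<open>q\<close> and \<open>t\<close> the ranks at all \<open>i \<le> B\<close> run through
  \<open>{1..B + 1}\<close>.
\<close>

lemma sum_rejection_exchangeable:
  fixes v :: "'g \<Rightarrow> real"
  assumes \<alpha>: "0 < \<alpha>" "\<alpha> < 1"
  shows "(\<Sum>q\<in>{..B} \<rightarrow>\<^sub>E G. \<Sum>t | t permutes {..B}.
            conditional_rejection \<alpha> B (test_rank B (\<lambda>b. v (q b)) t))
         = \<alpha> * real (card G) ^ Suc B * fact (Suc B)"
proof -
  let ?Q = "{..B} \<rightarrow>\<^sub>E G" and ?S = "{t. t permutes {..B}}"
  let ?c = "\<lambda>i q t. conditional_rejection \<alpha> B (rank_at i B (\<lambda>b. v (q b)) t)"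
  \<comment> \<open>The tie-breaking value \<open>t b\<close> belongs to position \<open>b\<close>, so \<open>t\<close> is transposed together with \<open>q\<close>; this is
    where the uniform distribution of the ranking enters.\<close>
  have symmetric: "(\<Sum>q\<in>?Q. \<Sum>t\<in>?S. ?c i q t) = (\<Sum>q\<in>?Q. \<Sum>t\<in>?S. ?c 0 q t)"
    if i: "i \<in> {..B}" for i
  proof -
    define \<sigma> where "\<sigma> = Transposition.transpose 0 i"
    have \<sigma>: "\<sigma> permutes {..B}" "\<sigma> 0 = i"
      using i by (auto simp: \<sigma>_def permutes_swap_id)
    have \<sigma>\<sigma>: "\<sigma> (\<sigma> b) = b" for b by (simp add: \<sigma>_def)
    have in_iff: "\<sigma> b \<le> B \<longleftrightarrow> b \<le> B" for b
      using permutes_in_image[OF \<sigma>(1), of b] by simp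
    have perm: "t \<circ> \<sigma> \<in> ?S" if "t \<in> ?S" for t
      using that permutes_compose[OF \<sigma>(1), of t] by simp
    have pie: "q \<circ> \<sigma> \<in> ?Q" if "q \<in> ?Q" for q
      using that in_iff by (auto simp: PiE_iff extensional_def)
    have "(\<Sum>q\<in>?Q. \<Sum>t\<in>?S. ?c 0 q t) = (\<Sum>q\<in>?Q. \<Sum>t\<in>?S. ?c 0 (q \<circ> \<sigma>) (t \<circ> \<sigma>))"
    proof -
      have "(\<Sum>q\<in>?Q. \<Sum>t\<in>?S. ?c 0 q t) = (\<Sum>q\<in>?Q. \<Sum>t\<in>?S. ?c 0 (q \<circ> \<sigma>) t)"
        by (rule sum.reindex_bij_witness[of _ "\<lambda>q. q \<circ> \<sigma>" "\<lambda>q. q \<circ> \<sigma>"])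
           (use pie in \<open>auto simp: fun_eq_iff \<sigma>\<sigma>\<close>)
      also have "\<dots> = (\<Sum>q\<in>?Q. \<Sum>t\<in>?S. ?c 0 (q \<circ> \<sigma>) (t \<circ> \<sigma>))"
        by (rule sum.cong[OF refl], rule sum.reindex_bij_witness[of _ "\<lambda>t. t \<circ> \<sigma>" "\<lambda>t. t \<circ> \<sigma>"])
           (use perm in \<open>auto simp: o_def \<sigma>\<sigma>\<close>)
      finally show ?thesis .
    qed
    also have "\<dots> = (\<Sum>q\<in>?Q. \<Sum>t\<in>?S. ?c i q t)"
    proof (intro sum.cong refl)
      fix q t
      show "?c 0 (q \<circ> \<sigma>) (t \<circ> \<sigma>) = ?c i q t"
        using rank_at_permute[OF \<sigma>(1), of 0 "\<lambda>b. v (q b)" t] by (simp only: o_def \<sigma>(2))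
    qed
    finally show ?thesis by simp
  qed
  have "(real B + 1) * (\<Sum>q\<in>?Q. \<Sum>t\<in>?S. ?c 0 q t) = (\<Sum>i\<in>{..B}. \<Sum>q\<in>?Q. \<Sum>t\<in>?S. ?c i q t)"
    by (simp only: sum.cong[OF refl symmetric] sum_constant card_atMost) simp
  also have "\<dots> = (\<Sum>q\<in>?Q. \<Sum>t\<in>?S. \<Sum>i\<in>{..B}. ?c i q t)"
    by (subst sum.swap, rule sum.cong[OF refl], rule sum.swap)
  also have "\<dots> = (\<Sum>q\<in>?Q. \<Sum>t\<in>?S. \<alpha> * (real B + 1))"
  proof (intro sum.cong refl)
    fix q t assume "t \<in> ?S"
    then have "inj_on t {..B}" by (auto intro: permutes_inj_on)
    from sum.reindex_bij_betw[OF rank_at_bij_betw[OF this], of "conditional_rejection \<alpha> B"]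
    show "(\<Sum>i\<in>{..B}. ?c i q t) = \<alpha> * (real B + 1)"
      by (simp only: sum_conditional_rejection[OF \<alpha>])
  qed
  also have "\<dots> = (real B + 1) * (\<alpha> * real (card G) ^ Suc B * fact (Suc B))"
    by (simp add: card_PiE card_permutations[of "{..B}" "Suc B"] del: fact_Suc power_Suc)
  finally show ?thesis
    by (simp add: test_rank_eq_rank_at_0 del: fact_Suc power_Suc)
qed

lemma conditional_rejection_bounds: "\<bar>conditional_rejection \<alpha> B r\<bar> \<le> 1"
  by (simp add: conditional_rejection_def)

lemma test_rank_cong:
  assumes "\<And>b. b \<in> {..B} \<Longrightarrow> T b = T' b"
  shows "test_rank B T t = test_rank B T' t"
  using assms unfolding test_rank_def by (intro arg_cong[where f="\<lambda>A. 1 + card A"]) auto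

lemma borel_measurable_conditional_rejection:
  assumes T: "\<And>b. b \<in> {..B} \<Longrightarrow> T b \<in> borel_measurable K"
    and t: "t \<in> K \<rightarrow>\<^sub>M count_space UNIV"
  shows "(\<lambda>x. conditional_rejection \<alpha> B (test_rank B (\<lambda>b. T b x) (t x))) \<in> borel_measurable K"
proof -
  have ties: "Measurable.pred K (\<lambda>x. t x b < t x 0)" for b
    using t by (rule measurable_compose) simp
  let ?precedes = "\<lambda>b x. T b x < T 0 x \<or> (T b x = T 0 x \<and> t x b < t x 0)"
  have "(\<lambda>x. if ?precedes b x then 1 else 0 :: real) \<in> borel_measurable K" if "b \<in> {1..B}" for b
  proof -
    have [measurable]: "T b \<in> borel_measurable K" "T 0 \<in> borel_measurable K"
      using T that by auto
    note ties[measurable]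
    show ?thesis by measurable
  qed
  then have "(\<lambda>x. \<Sum>b\<in>{1..B}. if ?precedes b x then 1 else 0 :: real) \<in> borel_measurable K"
    by (rule borel_measurable_sum)
  moreover have "real (test_rank B (\<lambda>b. T b x) (t x)) = 1 + (\<Sum>b\<in>{1..B}. if ?precedes b x then 1 else 0)" for x
    by (simp add: test_rank_def sum.If_cases Int_def)
  ultimately show ?thesis
    unfolding conditional_rejection_def by simp
qed

section \<open>Expectations over finitely many independent values\<close>

lemma Int_stable_preimages: "Int_stable {X -` A \<inter> \<Omega> | A. A \<in> sets N}"
proof (rule Int_stableI)
  fix a b assume "a \<in> {X -` A \<inter> \<Omega> | A. A \<in> sets N}" "b \<in> {X -` A \<inter> \<Omega> | A. A \<in> sets N}"
  then obtain A A' where "A \<in> sets N" "A' \<in> sets N" "a = X -` A \<inter> \<Omega>" "b = X -` A' \<inter> \<Omega>"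
    by auto
  then have "a \<inter> b = X -` (A \<inter> A') \<inter> \<Omega> \<and> A \<inter> A' \<in> sets N"
    by auto
  then show "a \<inter> b \<in> {X -` A \<inter> \<Omega> | A. A \<in> sets N}"
    by blast
qed

text \<open>
  Split the expectation along the values of \<open>V\<close>: on the event \<open>V = v\<close> the integrand is
  \<open>f (U \<omega>) v\<close>, which is independent of the indicator of this event.
\<close>

lemma (in prob_space) expectation_indep_pair_finite:
  fixes f :: "'b \<Rightarrow> 'c \<Rightarrow> real"
  assumes indep: "indep_pair N U K V"
    and S: "finite S" "\<And>v. v \<in> S \<Longrightarrow> {v} \<in> sets K" "AE \<omega> in M. V \<omega> \<in> S"
    and f: "case_prod f \<in> borel_measurable (N \<Otimes>\<^sub>M K)"
    and bound: "\<And>u v. \<bar>f u v\<bar> \<le> C"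
  shows "expectation (\<lambda>\<omega>. f (U \<omega>) (V \<omega>))
       = (\<Sum>v\<in>S. prob {\<omega> \<in> space M. V \<omega> = v} * expectation (\<lambda>\<omega>. f (U \<omega>) v))"
proof -
  have U[measurable]: "U \<in> M \<rightarrow>\<^sub>M N" and V[measurable]: "V \<in> M \<rightarrow>\<^sub>M K"
    using indep by (auto simp: indep_pair_def)
  have fv: "(\<lambda>u. f u v) \<in> borel_measurable N" if "v \<in> S" for v
  proof -
    have "v \<in> space K" using S(2)[OF that] sets.sets_into_space by blast
    from measurable_compose[OF measurable_Pair2'[OF this] f] show ?thesis by simp
  qed
  have fUv: "(\<lambda>\<omega>. f (U \<omega>) v) \<in> borel_measurable M" if "v \<in> S" for v
    by (rule measurable_compose[OF U fv[OF that]])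
  have fUV: "(\<lambda>\<omega>. f (U \<omega>) (V \<omega>)) \<in> borel_measurable M"
    using measurable_compose[OF measurable_Pair[OF U V] f] by simp
  have event: "{\<omega> \<in> space M. V \<omega> = v} = V -` {v} \<inter> space M" for v
    by auto
  have V_event: "{\<omega> \<in> space M. V \<omega> = v} \<in> events" if "v \<in> S" for v
    unfolding event using V S(2)[OF that] by (rule measurable_sets)
  let ?I = "\<lambda>v \<omega>. indicator {\<omega> \<in> space M. V \<omega> = v} \<omega> :: real"
  have prod: "expectation (\<lambda>\<omega>. ?I v \<omega> * f (U \<omega>) v)
            = prob {\<omega> \<in> space M. V \<omega> = v} * expectation (\<lambda>\<omega>. f (U \<omega>) v)"
    and int: "integrable M (\<lambda>\<omega>. ?I v \<omega> * f (U \<omega>) v)" if v: "v \<in> S" for v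
  proof -
    note [measurable] = V_event[OF v] fUv[OF v]
    have "indep_set {U -` A \<inter> space M | A. A \<in> sets N} {V -` A \<inter> space M | A. A \<in> sets K}"
      using indep by (simp add: indep_pair_def)
    then have "indep_set {(\<lambda>\<omega>. f (U \<omega>) v) -` A \<inter> space M | A. A \<in> sets borel}
                         {?I v -` A \<inter> space M | A. A \<in> sets borel}"
      unfolding indep_set_def
    proof (rule indep_sets_mono_sets)
      fix i :: bool
      have "\<exists>A'. (\<lambda>\<omega>. f (U \<omega>) v) -` A \<inter> space M = U -` A' \<inter> space M \<and> A' \<in> sets N"
        if "A \<in> sets borel" for A
        using measurable_sets[OF fv[OF v] that] measurable_space[OF U]
        by (intro exI[of _ "(\<lambda>u. f u v) -` A \<inter> space N"]) auto
      moreover have "\<exists>A'. ?I v -` A \<inter> space M = V -` A' \<inter> space M \<and> A' \<in> sets K"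
        if "A \<in> sets borel" for A
      proof -
        have "(\<lambda>x. indicator {v} x :: real) \<in> borel_measurable K"
          using S(2)[OF v] by simp
        from measurable_sets[OF this that] show ?thesis
          using measurable_space[OF V]
          by (intro exI[of _ "(\<lambda>x. indicator {v} x :: real) -` A \<inter> space K"])
             (auto simp: indicator_def)
      qed
      ultimately show "case_bool {(\<lambda>\<omega>. f (U \<omega>) v) -` A \<inter> space M | A. A \<in> sets borel}
          {?I v -` A \<inter> space M | A. A \<in> sets borel} i
        \<subseteq> case_bool {U -` A \<inter> space M | A. A \<in> sets N} {V -` A \<inter> space M | A. A \<in> sets K} i"
        by (cases i) auto
    qed
    then have "indep_set
        (sigma_sets (space M) {(\<lambda>\<omega>. f (U \<omega>) v) -` A \<inter> space M | A. A \<in> sets borel})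
        (sigma_sets (space M) {?I v -` A \<inter> space M | A. A \<in> sets borel})"
      by (rule indep_set_sigma_sets[OF _ Int_stable_preimages Int_stable_preimages])
    then have ind: "indep_var borel (\<lambda>\<omega>. f (U \<omega>) v) borel (?I v)"
      by (simp add: indep_var_eq)
    have int1: "integrable M (\<lambda>\<omega>. f (U \<omega>) v)"
      by (rule integrable_const_bound[where B=C]) (auto simp: bound)
    have int2: "integrable M (?I v)"
      by (rule integrable_const_bound[where B=1]) (auto simp: indicator_def)
    have "expectation (?I v) = prob {\<omega> \<in> space M. V \<omega> = v}"
      by simp
    then show "expectation (\<lambda>\<omega>. ?I v \<omega> * f (U \<omega>) v)
            = prob {\<omega> \<in> space M. V \<omega> = v} * expectation (\<lambda>\<omega>. f (U \<omega>) v)"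
      using indep_var_lebesgue_integral[OF ind int1 int2] by (simp add: mult.commute)
    show "integrable M (\<lambda>\<omega>. ?I v \<omega> * f (U \<omega>) v)"
      using indep_var_integrable[OF ind int1 int2] by (simp add: mult.commute)
  qed
  have "expectation (\<lambda>\<omega>. f (U \<omega>) (V \<omega>)) = expectation (\<lambda>\<omega>. \<Sum>v\<in>S. ?I v \<omega> * f (U \<omega>) v)"
  proof (rule integral_cong_AE)
    show "(\<lambda>\<omega>. \<Sum>v\<in>S. ?I v \<omega> * f (U \<omega>) v) \<in> borel_measurable M"
      using int by (intro borel_measurable_sum) auto
    show "AE \<omega> in M. f (U \<omega>) (V \<omega>) = (\<Sum>v\<in>S. ?I v \<omega> * f (U \<omega>) v)"
      using S(3)
    proof (rule AE_mp, intro AE_I2 impI)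
      fix \<omega> assume \<omega>: "\<omega> \<in> space M" "V \<omega> \<in> S"
      have "(\<Sum>v\<in>S. ?I v \<omega> * f (U \<omega>) v) = (\<Sum>v\<in>S. if V \<omega> = v then f (U \<omega>) v else 0)"
        using \<omega>(1) by (intro sum.cong) (auto simp: indicator_def)
      then show "f (U \<omega>) (V \<omega>) = (\<Sum>v\<in>S. ?I v \<omega> * f (U \<omega>) v)"
        using S(1) \<omega>(2) by simp
    qed
  qed (rule fUV)
  also have "\<dots> = (\<Sum>v\<in>S. prob {\<omega> \<in> space M. V \<omega> = v} * expectation (\<lambda>\<omega>. f (U \<omega>) v))"
    using int prod by simp
  finally show ?thesis .
qed

lemma (in prob_space) prob_eq_pmf_of_distr:
  assumes "X \<in> M \<rightarrow>\<^sub>M count_space UNIV" "distr M (count_space UNIV) X = measure_pmf law"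
  shows "prob {\<omega> \<in> space M. X \<omega> = x} = pmf law x"
proof -
  have "pmf law x = measure (distr M (count_space UNIV) X) {x}"
    by (simp add: assms(2) pmf.rep_eq)
  also have "\<dots> = prob (X -` {x} \<inter> space M)"
    using assms(1) by (rule measure_distr) simp
  finally show ?thesis
    by (simp add: vimage_def Int_def conj_commute)
qed

lemma (in prob_space) AE_in_set_pmf_of_distr:
  assumes "X \<in> M \<rightarrow>\<^sub>M count_space UNIV" "distr M (count_space UNIV) X = measure_pmf law"
  shows "AE \<omega> in M. X \<omega> \<in> set_pmf law"
proof -
  have "AE x in distr M (count_space UNIV) X. x \<in> set_pmf law"
    unfolding assms(2) by (rule AE_measure_pmf)
  then show ?thesis
    using assms(1) by (simp add: AE_distr_iff)
qed

section \<open>Averaging over a group acting on the data\<close>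

text \<open>
  If \<open>g, p 1, \<dots>, p B\<close> run independently through \<open>G\<close>, so do
  \<open>g, g \<circ> p 1, \<dots>, g \<circ> p B\<close>. The entry of \<open>p\<close> at \<open>0\<close> is set to \<open>id\<close>, which stands for the
  original data. The map is injective, since its entry at \<open>0\<close> recovers \<open>g\<close>, and it is onto because
  both sides have \<open>card G ^ (B + 1)\<close> elements.
\<close>

lemma sum_translates:
  fixes h :: "(nat \<Rightarrow> 'a \<Rightarrow> 'a) \<Rightarrow> real"
  assumes fin: "finite G" and inj: "\<And>g. g \<in> G \<Longrightarrow> inj g"
    and closed: "\<And>g k. g \<in> G \<Longrightarrow> k \<in> G \<Longrightarrow> g \<circ> k \<in> G"
  shows "(\<Sum>g\<in>G. \<Sum>p\<in>{1..B} \<rightarrow>\<^sub>E G. h (\<lambda>b\<in>{..B}. g \<circ> (p(0 := id)) b)) = (\<Sum>q\<in>{..B} \<rightarrow>\<^sub>E G. h q)"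
proof -
  let ?m = "\<lambda>(g, p). \<lambda>b\<in>{..B}. g \<circ> (p(0 := id :: 'a \<Rightarrow> 'a)) b"
  let ?X = "G \<times> ({1..B} \<rightarrow>\<^sub>E G)"
  have "inj_on ?m ?X"
  proof (rule inj_onI)
    fix x y assume x: "x \<in> ?X" and y: "y \<in> ?X" and eq: "?m x = ?m y"
    obtain g p k r where xy: "x = (g, p)" "y = (k, r)" by (cases x, cases y)
    have eq': "g \<circ> (p(0 := id)) b = k \<circ> (r(0 := id)) b" if "b \<le> B" for b
      using fun_cong[OF eq, of b] that by (simp add: xy)
    from eq'[of 0] have gk: "g = k" by simp
    have "p b = r b" if "b \<in> {1..B}" for b
    proof -
      have "g \<circ> p b = g \<circ> r b" using eq'[of b] that gk by simp
      then show ?thesis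
        using inj[of g] x by (auto simp: xy fun_eq_iff inj_eq)
    qed
    then have "p = r"
      by (rule PiE_ext[where k="{1..B}" and s="\<lambda>_. G", rotated 2]) (use x y in \<open>auto simp: xy\<close>)
    with gk show "x = y" by (simp add: xy)
  qed
  moreover have "?m ` ?X = {..B} \<rightarrow>\<^sub>E G"
  proof (rule card_subset_eq)
    show "finite ({..B} \<rightarrow>\<^sub>E G)" using fin by (intro finite_PiE) auto
    show "?m ` ?X \<subseteq> {..B} \<rightarrow>\<^sub>E G"
    proof
      fix q assume "q \<in> ?m ` ?X"
      then obtain g p where gp: "g \<in> G" "p \<in> {1..B} \<rightarrow>\<^sub>E G" "q = ?m (g, p)" by auto
      have "g \<circ> (p(0 := id)) b \<in> G" if "b \<le> B" for b
        using gp(1,2) closed[OF gp(1)] that by (cases "b = 0") (auto simp: PiE_iff)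
      then show "q \<in> {..B} \<rightarrow>\<^sub>E G" by (auto simp: gp(3))
    qed
    show "card (?m ` ?X) = card ({..B} \<rightarrow>\<^sub>E G)"
      using card_image[OF \<open>inj_on ?m ?X\<close>] by (simp add: card_PiE card_cartesian_product)
  qed
  ultimately have "bij_betw ?m ?X ({..B} \<rightarrow>\<^sub>E G)"
    by (simp add: bij_betw_def)
  from sum.reindex_bij_betw[OF this, of h] show ?thesis
    by (simp add: sum.cartesian_product case_prod_unfold)
qed

lemma (in permutation_draws) prob_draws_eq:
  assumes law: "law = pmf_of_set G" and G: "finite G" "G \<noteq> {}"
    and p: "p \<in> {1..B} \<rightarrow>\<^sub>E G"
  shows "prob {\<omega> \<in> space M. (\<lambda>b\<in>{1..B}. \<pi> b \<omega>) = p} = (1 / card G) ^ B"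
proof (cases "B = 0")
  case True
  have "p = (\<lambda>_. undefined)" using p True by simp
  then show ?thesis by (simp add: True prob_space restrict_def)
next
  case False
  have rv: "\<pi> b \<in> M \<rightarrow>\<^sub>M count_space UNIV" if "b \<in> {1..B}" for b
    using draws_indep that by (auto simp: indep_vars_def)
  have "{\<omega> \<in> space M. (\<lambda>b\<in>{1..B}. \<pi> b \<omega>) = p} = (\<Inter>b\<in>{1..B}. \<pi> b -` {p b} \<inter> space M)" (is "?L = ?R")
  proof
    show "?L \<subseteq> ?R" by auto
    show "?R \<subseteq> ?L"
    proof
      fix \<omega> assume \<omega>: "\<omega> \<in> ?R"
      have "(\<lambda>b\<in>{1..B}. \<pi> b \<omega>) = p"
        by (rule extensionalityI[where A="{1..B}"]) (use p \<omega> in \<open>auto simp: PiE_def\<close>)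
      then show "\<omega> \<in> ?L" using \<omega> False by auto
    qed
  qed
  also have "prob ?R = (\<Prod>b\<in>{1..B}. prob (\<pi> b -` {p b} \<inter> space M))"
    by (rule indep_varsD_finite[OF draws_indep]) (use False in auto)
  also have "\<dots> = (\<Prod>b\<in>{1..B}. 1 / card G)"
  proof (rule prod.cong[OF refl])
    fix b assume b: "b \<in> {1..B}"
    have "prob {\<omega> \<in> space M. \<pi> b \<omega> = p b} = pmf law (p b)"
      by (rule prob_eq_pmf_of_distr[OF rv[OF b] draws_law[OF b]])
    also have "\<dots> = 1 / card G"
      using PiE_mem[OF p b] G by (simp add: law)
    finally show "prob (\<pi> b -` {p b} \<inter> space M) = 1 / card G"
      by (simp add: vimage_def Int_def conj_commute)
  qed
  finally show ?thesis by simp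
qed

text \<open>
  The tie-breaking ranking is independent of the data and the draws together, and the draws are
  independent of the data, so the expectation splits in two steps: first along the values of the
  ranking, then along those of the draws.
\<close>

lemma (in permutation_draws) expectation_draws_and_ties:
  assumes law: "law = pmf_of_set G" and G: "finite G" "G \<noteq> {}"
    and f: "(\<lambda>((d, p), t). f d p t) \<in>
              borel_measurable ((N \<Otimes>\<^sub>M Pi\<^sub>M {1..B} (\<lambda>_. count_space UNIV)) \<Otimes>\<^sub>M count_space UNIV)"
    and bound: "\<And>d p t. \<bar>f d p t :: real\<bar> \<le> C"
    and data: "distr M N D = N"
  shows "expectation (\<lambda>\<omega>. f (D \<omega>) (\<lambda>b\<in>{1..B}. \<pi> b \<omega>) (\<tau> \<omega>))
       = (\<Sum>t | t permutes {..B}. \<Sum>p\<in>{1..B} \<rightarrow>\<^sub>E G. integral\<^sup>L N (\<lambda>d. f d p t))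
         / (fact (Suc B) * real (card G) ^ B)"
proof -
  let ?K = "Pi\<^sub>M {1..B} (\<lambda>_. count_space UNIV) :: (nat \<Rightarrow> nat \<Rightarrow> nat) measure"
  let ?S = "{t. t permutes {..B}}" and ?p = "\<lambda>\<omega>. \<lambda>b\<in>{1..B}. \<pi> b \<omega>"
  have rv: "\<pi> b \<in> M \<rightarrow>\<^sub>M count_space UNIV" if "b \<in> {1..B}" for b
    using draws_indep that by (auto simp: indep_vars_def)
  have D[measurable]: "D \<in> M \<rightarrow>\<^sub>M N" using draws_indep_data by (simp add: indep_pair_def)
  have \<tau>: "\<tau> \<in> M \<rightarrow>\<^sub>M count_space UNIV" using ties_indep by (simp add: indep_pair_def)
  have perms: "finite ?S" "?S \<noteq> {}" "card ?S = fact (Suc B)"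
    by (auto simp: finite_permutations card_permutations[of "{..B}" "Suc B"] permutes_id intro: exI[of _ id])
  have ft: "(\<lambda>(d, p). f d p t) \<in> borel_measurable (N \<Otimes>\<^sub>M ?K)" for t
    using measurable_compose[OF measurable_Pair2' f, of t] by (simp add: case_prod_unfold)
  have fpt: "(\<lambda>d. f d p t) \<in> borel_measurable N" if "p \<in> {1..B} \<rightarrow>\<^sub>E G" for p t
  proof -
    have "p \<in> space ?K" using that by (auto simp: space_PiM PiE_iff)
    from measurable_compose[OF measurable_Pair2'[OF this] ft] show ?thesis by simp
  qed
  have "expectation (\<lambda>\<omega>. f (D \<omega>) (?p \<omega>) (\<tau> \<omega>))
      = expectation (\<lambda>\<omega>. (\<lambda>(d, p). f d p) (D \<omega>, ?p \<omega>) (\<tau> \<omega>))"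
    by simp
  also have "\<dots> = (\<Sum>t\<in>?S. prob {\<omega> \<in> space M. \<tau> \<omega> = t} * expectation (\<lambda>\<omega>. (\<lambda>(d, p). f d p) (D \<omega>, ?p \<omega>) t))"
  proof (rule expectation_indep_pair_finite[OF ties_indep, where C=C])
    show "AE \<omega> in M. \<tau> \<omega> \<in> ?S"
      using AE_in_set_pmf_of_distr[OF \<tau> ties_law] by (simp only: set_pmf_of_set[OF perms(2,1)])
    show "case_prod (\<lambda>(d, p). f d p) \<in> borel_measurable ((N \<Otimes>\<^sub>M ?K) \<Otimes>\<^sub>M count_space UNIV)"
      using f by (simp add: case_prod_unfold)
  qed (use perms bound in \<open>auto split: prod.split\<close>)
  also have "\<dots> = (\<Sum>t\<in>?S. 1 / fact (Suc B) * expectation (\<lambda>\<omega>. f (D \<omega>) (?p \<omega>) t))"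
  proof (rule sum.cong[OF refl])
    fix t assume "t \<in> ?S"
    then show "prob {\<omega> \<in> space M. \<tau> \<omega> = t} * expectation (\<lambda>\<omega>. (\<lambda>(d, p). f d p) (D \<omega>, ?p \<omega>) t)
      = 1 / fact (Suc B) * expectation (\<lambda>\<omega>. f (D \<omega>) (?p \<omega>) t)"
      using prob_eq_pmf_of_distr[OF \<tau> ties_law, of t] perms by (simp del: fact_Suc)
  qed
  also have "\<dots> = (\<Sum>t\<in>?S. 1 / fact (Suc B) *
      (\<Sum>p\<in>{1..B} \<rightarrow>\<^sub>E G. (1 / card G) ^ B * integral\<^sup>L N (\<lambda>d. f d p t)))"
  proof (intro sum.cong[OF refl] arg_cong[where f="\<lambda>x. 1 / fact (Suc B) * x"])
    fix t
    have "expectation (\<lambda>\<omega>. f (D \<omega>) (?p \<omega>) t)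
        = (\<Sum>p\<in>{1..B} \<rightarrow>\<^sub>E G. prob {\<omega> \<in> space M. ?p \<omega> = p} * expectation (\<lambda>\<omega>. f (D \<omega>) p t))"
    proof (rule expectation_indep_pair_finite[OF draws_indep_data, where C=C])
      show "finite ({1..B} \<rightarrow>\<^sub>E G)" using G by (intro finite_PiE) auto
      show "{p} \<in> sets ?K" if "p \<in> {1..B} \<rightarrow>\<^sub>E G" for p
      proof -
        have "{p} = Pi\<^sub>E {1..B} (\<lambda>b. {p b})"
          using that by (intro PiE_singleton[symmetric]) (simp add: PiE_def)
        also have "\<dots> \<in> sets ?K" by (intro sets_PiM_I_finite) auto
        finally show ?thesis .
      qed
      have "AE \<omega> in M. \<forall>b\<in>{1..B}. \<pi> b \<omega> \<in> G"
        using AE_in_set_pmf_of_distr[OF rv draws_law] G by (intro AE_finite_allI) (auto simp: law)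
      then show "AE \<omega> in M. ?p \<omega> \<in> {1..B} \<rightarrow>\<^sub>E G"
        by (rule AE_mp) (auto intro!: AE_I2)
      show "(\<lambda>(d, p). f d p t) \<in> borel_measurable (N \<Otimes>\<^sub>M ?K)" by (rule ft)
    qed (rule bound)
    also have "\<dots> = (\<Sum>p\<in>{1..B} \<rightarrow>\<^sub>E G. (1 / card G) ^ B * integral\<^sup>L N (\<lambda>d. f d p t))"
    proof (rule sum.cong[OF refl])
      fix p assume p: "p \<in> {1..B} \<rightarrow>\<^sub>E G"
      have "expectation (\<lambda>\<omega>. f (D \<omega>) p t) = integral\<^sup>L (distr M N D) (\<lambda>d. f d p t)"
        by (rule integral_distr[symmetric, OF D fpt[OF p]])
      then show "prob {\<omega> \<in> space M. ?p \<omega> = p} * expectation (\<lambda>\<omega>. f (D \<omega>) p t)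
        = (1 / card G) ^ B * integral\<^sup>L N (\<lambda>d. f d p t)"
        by (simp only: data prob_draws_eq[OF law G p])
    qed
    finally show "expectation (\<lambda>\<omega>. f (D \<omega>) (?p \<omega>) t)
      = (\<Sum>p\<in>{1..B} \<rightarrow>\<^sub>E G. (1 / card G) ^ B * integral\<^sup>L N (\<lambda>d. f d p t))" .
  qed
  also have "\<dots> = (\<Sum>t\<in>?S. \<Sum>p\<in>{1..B} \<rightarrow>\<^sub>E G. integral\<^sup>L N (\<lambda>d. f d p t))
         / (fact (Suc B) * real (card G) ^ B)"
    by (simp add: sum_distrib_left sum_divide_distrib power_divide divide_divide_eq_left del: fact_Suc)
  finally show ?thesis .
qed

text \<open>
  The exact level of a permutation test, for a group \<open>G\<close> whose action on the data preserves their
  law. Each integral over the data may be shifted by any \<open>g\<close> in \<open>G\<close>; averaging over \<open>g\<close> replaces the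
  identity, which the original statistic uses, by a further uniform element of \<open>G\<close>. Nonemptiness
  and closure under composition make \<open>G\<close> a group because it consists of permutations of a finite
  set.
\<close>

lemma (in permutation_draws) rejection_probability_eq_level:
  fixes F :: "'d \<Rightarrow> (nat \<Rightarrow> nat) \<Rightarrow> real" and act :: "(nat \<Rightarrow> nat) \<Rightarrow> 'd \<Rightarrow> 'd"
  assumes level: "0 < \<alpha>" "\<alpha> < 1"
    and law: "law = pmf_of_set G"
    and G: "G \<noteq> {}" "\<And>g. g \<in> G \<Longrightarrow> g permutes {..<s}" "\<And>g k. g \<in> G \<Longrightarrow> k \<in> G \<Longrightarrow> g \<circ> k \<in> G"
    and data: "distr M N D = N"
    and F: "\<And>p. p permutes {..<s} \<Longrightarrow> (\<lambda>d. F d p) \<in> borel_measurable N"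
    and act: "\<And>g. g \<in> G \<Longrightarrow> act g \<in> N \<rightarrow>\<^sub>M N" "\<And>g. g \<in> G \<Longrightarrow> distr N N (act g) = N"
    and equivariant: "\<And>g p d. g \<in> G \<Longrightarrow> p permutes {..<s} \<Longrightarrow> d \<in> space N \<Longrightarrow> F (act g d) p = F d (g \<circ> p)"
    and T_0: "\<And>\<omega>. \<omega> \<in> space M \<Longrightarrow> T 0 \<omega> = F (D \<omega>) id"
    and T: "\<And>b \<omega>. b \<in> {1..B} \<Longrightarrow> \<omega> \<in> space M \<Longrightarrow> T b \<omega> = F (D \<omega>) (\<pi> b \<omega>)"
  shows "rejection_probability M \<alpha> B T \<tau> = \<alpha>"
proof -
  let ?K = "Pi\<^sub>M {1..B} (\<lambda>_. count_space UNIV) :: (nat \<Rightarrow> nat \<Rightarrow> nat) measure"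
  let ?perms = "{p. p permutes {..<s}}" and ?S = "{t. t permutes {..B}}"
  \<comment> \<open>Nothing is known about \<open>F d p\<close> when \<open>p\<close> is not a permutation of the bins. Setting it to \<open>0\<close> there
    makes the statistic jointly measurable in the data and the draws.\<close>
  define F' where "F' d p = (\<Sum>q\<in>?perms. if p = q then F d q else 0)" for d p
  have finite_perms: "finite ?perms" by (simp add: finite_permutations)
  have F'_eq: "F' d p = F d p" if "p permutes {..<s}" for d p
    using that finite_perms by (simp add: F'_def)
  define rej where "rej d q t = conditional_rejection \<alpha> B (test_rank B (\<lambda>b. F' d (q b)) t)" for d q t
  have finG: "finite G" by (rule finite_subset[OF _ finite_perms]) (use G(2) in auto)
  have bound: "\<bar>rej d q t\<bar> \<le> 1" for d q t
    by (simp add: rej_def conditional_rejection_bounds)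

  have F_meas: "(\<lambda>x. F' (d x) (p x)) \<in> borel_measurable L"
    if d: "d \<in> L \<rightarrow>\<^sub>M N" and p[measurable]: "p \<in> L \<rightarrow>\<^sub>M count_space UNIV" for L :: "'e measure" and d p
    unfolding F'_def
  proof (rule borel_measurable_sum)
    fix q assume "q \<in> ?perms"
    then have [measurable]: "(\<lambda>x. F (d x) q) \<in> borel_measurable L"
      using measurable_compose[OF d F] by simp
    have [measurable]: "Measurable.pred L (\<lambda>x. p x = q)"
      using p by (rule measurable_compose) simp
    show "(\<lambda>x. if p x = q then F (d x) q else 0) \<in> borel_measurable L" by measurable
  qed
  have rej_meas: "(\<lambda>((d, p), t). rej d (p(0 := id)) t) \<in> borel_measurable ((N \<Otimes>\<^sub>M ?K) \<Otimes>\<^sub>M count_space UNIV)"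
    unfolding rej_def case_prod_unfold
  proof (rule borel_measurable_conditional_rejection)
    fix b assume b: "b \<in> {..B}"
    show "(\<lambda>x. F' (fst (fst x)) (((snd (fst x))(0 := id)) b)) \<in> borel_measurable ((N \<Otimes>\<^sub>M ?K) \<Otimes>\<^sub>M count_space UNIV)"
    proof (rule F_meas)
      show "(\<lambda>x. ((snd (fst x))(0 := id)) b) \<in> (N \<Otimes>\<^sub>M ?K) \<Otimes>\<^sub>M count_space UNIV \<rightarrow>\<^sub>M count_space UNIV"
      proof (cases "b = 0")
        case False
        then have "b \<in> {1..B}" using b by auto
        then have "(\<lambda>p. p b) \<in> ?K \<rightarrow>\<^sub>M count_space UNIV"
          by (rule measurable_component_singleton)
        then have "(\<lambda>x. snd (fst x) b) \<in> (N \<Otimes>\<^sub>M ?K) \<Otimes>\<^sub>M count_space UNIV \<rightarrow>\<^sub>M count_space UNIV"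
          by (rule measurable_compose[rotated]) simp
        then show ?thesis using False by simp
      qed simp
    qed simp
  qed simp
  have rej_meas_N: "(\<lambda>d. rej d q t) \<in> borel_measurable N" for q t
    unfolding rej_def by (intro borel_measurable_conditional_rejection F_meas) auto
  have rej_int: "integrable N (\<lambda>d. rej d q t)" for q t
  proof -
    interpret N: prob_space N
      using prob_space_distr[of D N] draws_indep_data by (simp add: data indep_pair_def)
    show ?thesis
      by (rule N.integrable_const_bound[where B=1]) (auto simp: bound rej_meas_N)
  qed

  \<comment> \<open>By the invariance of the law, \<open>d\<close> may be replaced by \<open>act g d\<close>; equivariance then moves \<open>g\<close> from the
    data to all \<open>B + 1\<close> permutations.\<close>
  have shift: "integral\<^sup>L N (\<lambda>d. rej d (p(0 := id)) t) = integral\<^sup>L N (\<lambda>d. rej d (\<lambda>b\<in>{..B}. g \<circ> (p(0 := id)) b) t)"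
    if g: "g \<in> G" and p: "p \<in> {1..B} \<rightarrow>\<^sub>E G" for g p t
  proof -
    have "integral\<^sup>L N (\<lambda>d. rej d (p(0 := id)) t) = integral\<^sup>L (distr N N (act g)) (\<lambda>d. rej d (p(0 := id)) t)"
      by (simp only: act(2)[OF g])
    also have "\<dots> = integral\<^sup>L N (\<lambda>d. rej (act g d) (p(0 := id)) t)"
      by (rule integral_distr[OF act(1)[OF g] rej_meas_N])
    also have "\<dots> = integral\<^sup>L N (\<lambda>d. rej d (\<lambda>b\<in>{..B}. g \<circ> (p(0 := id)) b) t)"
    proof (rule Bochner_Integration.integral_cong[OF refl])
      fix d assume d: "d \<in> space N"
      have "F' (act g d) ((p(0 := id)) b) = F' d ((\<lambda>b\<in>{..B}. g \<circ> (p(0 := id)) b) b)" if "b \<in> {..B}" for b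
      proof -
        have "(p(0 := id)) b permutes {..<s}"
          using p that G(2) by (cases "b = 0") (auto simp: PiE_iff permutes_id)
        then show ?thesis
          using that equivariant[OF g _ d] permutes_compose[OF _ G(2)[OF g]] by (simp add: F'_eq)
      qed
      then show "rej (act g d) (p(0 := id)) t = rej d (\<lambda>b\<in>{..B}. g \<circ> (p(0 := id)) b) t"
        unfolding rej_def by (intro arg_cong[where f="conditional_rejection \<alpha> B"] test_rank_cong)
    qed
    finally show ?thesis .
  qed
  have "real (card G) * (\<Sum>t\<in>?S. \<Sum>p\<in>{1..B} \<rightarrow>\<^sub>E G. integral\<^sup>L N (\<lambda>d. rej d (p(0 := id)) t))
      = (\<Sum>t\<in>?S. \<Sum>g\<in>G. \<Sum>p\<in>{1..B} \<rightarrow>\<^sub>E G. integral\<^sup>L N (\<lambda>d. rej d (p(0 := id)) t))"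
    by (simp add: sum_distrib_left)
  also have "\<dots> = (\<Sum>t\<in>?S. \<Sum>g\<in>G. \<Sum>p\<in>{1..B} \<rightarrow>\<^sub>E G. integral\<^sup>L N (\<lambda>d. rej d (\<lambda>b\<in>{..B}. g \<circ> (p(0 := id)) b) t))"
    by (intro sum.cong refl shift)
  also have "\<dots> = (\<Sum>t\<in>?S. \<Sum>q\<in>{..B} \<rightarrow>\<^sub>E G. integral\<^sup>L N (\<lambda>d. rej d q t))"
    by (intro sum.cong refl sum_translates[OF finG]) (blast intro: permutes_inj G)+
  also have "\<dots> = integral\<^sup>L N (\<lambda>d. \<Sum>q\<in>{..B} \<rightarrow>\<^sub>E G. \<Sum>t\<in>?S. rej d q t)"
    by (subst sum.swap) (simp add: rej_int)
  also have "\<dots> = integral\<^sup>L N (\<lambda>d. \<alpha> * real (card G) ^ Suc B * fact (Suc B))"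
    unfolding rej_def by (simp only: sum_rejection_exchangeable[OF level])
  also have "\<dots> = \<alpha> * real (card G) ^ Suc B * fact (Suc B)"
  proof -
    interpret N: prob_space N
      using prob_space_distr[of D N] draws_indep_data by (simp add: data indep_pair_def)
    show ?thesis by (simp add: N.prob_space)
  qed
  finally have total: "(\<Sum>t\<in>?S. \<Sum>p\<in>{1..B} \<rightarrow>\<^sub>E G. integral\<^sup>L N (\<lambda>d. rej d (p(0 := id)) t))
      = \<alpha> * (fact (Suc B) * real (card G) ^ B)"
    using finG G(1) by (simp add: field_simps del: fact_Suc)

  have "rejection_probability M \<alpha> B T \<tau>
      = expectation (\<lambda>\<omega>. rej (D \<omega>) ((\<lambda>b\<in>{1..B}. \<pi> b \<omega>)(0 := id)) (\<tau> \<omega>))"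
    unfolding rejection_probability_def rej_def
  proof (intro Bochner_Integration.integral_cong[OF refl] arg_cong[where f="conditional_rejection \<alpha> B"] test_rank_cong)
    fix \<omega> b assume "\<omega> \<in> space M" "b \<in> {..B}"
    then show "T b \<omega> = F' (D \<omega>) (((\<lambda>b\<in>{1..B}. \<pi> b \<omega>)(0 := id)) b)"
      using T_0 T[of b] draws_permute[of b] by (cases "b = 0") (auto simp: F'_eq permutes_id)
  qed
  also have "\<dots> = (\<Sum>t\<in>?S. \<Sum>p\<in>{1..B} \<rightarrow>\<^sub>E G. integral\<^sup>L N (\<lambda>d. rej d (p(0 := id)) t))
         / (fact (Suc B) * real (card G) ^ B)"
    by (rule expectation_draws_and_ties[OF law finG G(1) rej_meas bound data])
  also have "\<dots> = \<alpha>"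
    unfolding total using finG G(1) by (simp del: fact_Suc)
  finally show ?thesis .
qed

section \<open>Rearranging bins\<close>

lemma bin_size:
  fixes n s :: nat
  assumes "0 < n" "s dvd n"
  shows "0 < n div s" "n = s * (n div s)"
  using assms by (auto elim!: dvdE)

lemma bin_map_less:
  assumes n: "0 < n" "s dvd n" and p: "p permutes {..<s}" and i: "i < n"
  shows "bin_map n s p i < n"
proof -
  let ?m = "n div s"
  have "i div ?m < s"
    using i bin_size[OF n] by (metis less_mult_imp_div_less)
  then have "p (i div ?m) < s"
    using permutes_in_image[OF p, of "i div ?m"] by simp
  then have "p (i div ?m) * ?m + ?m \<le> s * ?m"
    by (metis Suc_leI add.commute mult_Suc mult_le_mono1)
  moreover have "i mod ?m < ?m" using bin_size(1)[OF n] by simp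
  ultimately show ?thesis
    using bin_size(2)[OF n] unfolding bin_map_def by linarith
qed

lemma bin_map_id: "bin_map n s id i = i"
  unfolding bin_map_def id_apply by (rule div_mult_mod_eq)

lemma bin_map_comp:
  assumes "0 < n" "s dvd n"
  shows "bin_map n s g (bin_map n s p i) = bin_map n s (g \<circ> p) i"
  using bin_size(1)[OF assms] by (simp add: bin_map_def)

lemma inj_on_bin_map:
  assumes "0 < n" "s dvd n" "p permutes {..<s}"
  shows "inj_on (bin_map n s p) A"
  using bin_map_comp[OF assms(1,2), of "inv p" p] permutes_inv_o(2)[OF assms(3)]
  by (intro inj_on_inverseI[where g="bin_map n s (inv p)"]) (simp add: bin_map_id)

text \<open>
  Rearranging the bins permutes the entries of an i.i.d. sample.
\<close>

lemma distr_PiM_bin_map: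
  assumes "prob_space P" and n: "0 < n" "s dvd n" and g: "g permutes {..<s}"
  shows "distr (Pi\<^sub>M {..<n} (\<lambda>_. P)) (Pi\<^sub>M {..<n} (\<lambda>_. P)) (\<lambda>d. \<lambda>i\<in>{..<n}. d (bin_map n s g i))
       = Pi\<^sub>M {..<n} (\<lambda>_. P)"
  using distr_PiM_reindex[of "{..<n}" "\<lambda>_. P" "bin_map n s g" "{..<n}"] assms(1)
    inj_on_bin_map[OF n g] bin_map_less[OF n g] by auto

lemma measurable_bin_map:
  assumes n: "0 < n" "s dvd n" and g: "g permutes {..<s}"
  shows "(\<lambda>d. \<lambda>i\<in>{..<n}. d (bin_map n s g i)) \<in> Pi\<^sub>M {..<n} (\<lambda>_. P) \<rightarrow>\<^sub>M Pi\<^sub>M {..<n} (\<lambda>_. P)"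
  using bin_map_less[OF n g]
  by (intro measurable_restrict measurable_component_singleton) auto

section \<open>The homogeneity test\<close>

lemma expectation_pair_empirical:
  fixes \<phi> :: "'a \<times> 'b \<Rightarrow> real"
  assumes "0 < n" "0 < m"
  shows "measure_pmf.expectation (pair_pmf (empirical n x) (empirical m y)) \<phi>
       = (\<Sum>i<n. \<Sum>j<m. \<phi> (x i, y j)) / (real n * real m)"
proof -
  have ne: "{..<n} \<noteq> {}" "{..<m} \<noteq> {}" using assms by auto
  have pairs: "pair_pmf (pmf_of_set {..<n}) (pmf_of_set {..<m}) = pmf_of_set ({..<n} \<times> {..<m})"
  proof (rule pmf_eqI)
    fix x :: "nat \<times> nat"
    have "{..<n} \<times> {..<m} \<noteq> {}" using assms by auto
    from pmf_of_set[OF this] show "pmf (pair_pmf (pmf_of_set {..<n}) (pmf_of_set {..<m})) x = pmf (pmf_of_set ({..<n} \<times> {..<m})) x"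
      by (cases x) (simp add: pmf_pair pmf_of_set[OF ne(1)] pmf_of_set[OF ne(2)] indicator_times)
  qed
  have "pair_pmf (empirical n x) (empirical m y)
      = map_pmf (\<lambda>(i, j). (x i, y j)) (pmf_of_set ({..<n} \<times> {..<m}))"
    by (simp add: empirical_def map_pair flip: pairs)
  then show ?thesis
    using ne by (simp add: integral_pmf_of_set sum.cartesian_product case_prod_unfold)
qed

lemma quadratic_statistic_cong:
  assumes "0 < n1" "0 < n2" "\<And>i. i < n1 \<Longrightarrow> y i = y' i" "\<And>j. j < n2 \<Longrightarrow> z j = z' j"
  shows "quadratic_statistic \<phi>1 \<phi>12 \<phi>2 n1 n2 y z = quadratic_statistic \<phi>1 \<phi>12 \<phi>2 n1 n2 y' z'"
  using assms by (simp add: quadratic_statistic_def expectation_pair_empirical)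

lemma borel_measurable_quadratic_statistic:
  assumes n: "0 < n1" "0 < n2"
    and \<phi>: "\<phi>1 \<in> borel_measurable (P \<Otimes>\<^sub>M P)" "\<phi>12 \<in> borel_measurable (P \<Otimes>\<^sub>M Q)" "\<phi>2 \<in> borel_measurable (Q \<Otimes>\<^sub>M Q)"
    and y: "\<And>i. i < n1 \<Longrightarrow> (\<lambda>d. y d i) \<in> N \<rightarrow>\<^sub>M P" and z: "\<And>j. j < n2 \<Longrightarrow> (\<lambda>d. z d j) \<in> N \<rightarrow>\<^sub>M Q"
  shows "(\<lambda>d. quadratic_statistic \<phi>1 \<phi>12 \<phi>2 n1 n2 (y d) (z d)) \<in> borel_measurable N"
  unfolding quadratic_statistic_def expectation_pair_empirical[OF n(1) n(1)]
    expectation_pair_empirical[OF n] expectation_pair_empirical[OF n(2) n(2)]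
  by (intro borel_measurable_add borel_measurable_divide borel_measurable_sum borel_measurable_const
        measurable_compose[OF measurable_Pair \<phi>(1)] measurable_compose[OF measurable_Pair \<phi>(2)]
        measurable_compose[OF measurable_Pair \<phi>(3)] y z) auto

text \<open>
  Under the null hypothesis the pooled sample is i.i.d., so that every rearrangement of its bins has
  the same law. The group is the full group of permutations of the bins.
\<close>

theorem (in cheap_homogeneity_test) homogeneity_rejection_probability:
  assumes level: "0 < \<alpha>" "\<alpha> < 1"
    and \<phi>: "\<phi>1 \<in> borel_measurable (P \<Otimes>\<^sub>M P)" "\<phi>12 \<in> borel_measurable (P \<Otimes>\<^sub>M Q)" "\<phi>2 \<in> borel_measurable (Q \<Otimes>\<^sub>M Q)"
    and null: "P = Q"
  shows "rejection_probability M \<alpha> B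
    (homogeneity_statistics (quadratic_statistic \<phi>1 \<phi>12 \<phi>2 n1 n2) n1 n2 s Y Z \<pi>) \<tau> = \<alpha>"
proof -
  let ?n = "n1 + n2"
  let ?G = "{p. p permutes {..<s}}" and ?N = "Pi\<^sub>M {..<?n} (\<lambda>_. P)"
  let ?T = "quadratic_statistic \<phi>1 \<phi>12 \<phi>2 n1 n2"
  let ?F = "\<lambda>d p. ?T (\<lambda>i. d (bin_map ?n s p i)) (\<lambda>j. d (bin_map ?n s p (n1 + j)))"
  let ?act = "\<lambda>g d. \<lambda>i\<in>{..<?n}. d (bin_map ?n s g i)"
  have n: "0 < ?n" "s dvd ?n" using sizes bins by auto
  note less = bin_map_less[OF n]
  have rv: "pooled n1 Y Z i \<in> M \<rightarrow>\<^sub>M P" if "i \<in> {..<?n}" for i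
    using data_indep that by (auto simp: indep_vars_def)
  have pooled_law: "distr M P (pooled n1 Y Z i) = P" if "i \<in> {..<?n}" for i
    using law_Y[of i] law_Z[of "i - n1"] that null by (auto simp: pooled_def)
  have data: "distr M ?N (\<lambda>\<omega>. \<lambda>i\<in>{..<?n}. pooled n1 Y Z i \<omega>) = ?N"
  proof -
    have "distr M ?N (\<lambda>\<omega>. \<lambda>i\<in>{..<?n}. pooled n1 Y Z i \<omega>) = Pi\<^sub>M {..<?n} (\<lambda>i. distr M P (pooled n1 Y Z i))"
      by (subst indep_vars_iff_distr_eq_PiM'[symmetric]) (use rv n data_indep in auto)
    also have "\<dots> = ?N" by (intro PiM_cong refl pooled_law)
    finally show ?thesis .
  qed
  show ?thesis
  proof (rule rejection_probability_eq_level[where G="?G" and F="?F" and act="?act", OF level refl])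
    show "?G \<noteq> {}" using permutes_id by blast
    show "g \<circ> k \<in> ?G" if "g \<in> ?G" "k \<in> ?G" for g k
      using that permutes_compose by auto
    show "distr M ?N (\<lambda>\<omega>. \<lambda>i\<in>{..<?n}. pooled n1 Y Z i \<omega>) = ?N" by (rule data)
    show "(\<lambda>d. ?F d p) \<in> borel_measurable ?N" if p: "p permutes {..<s}" for p
      by (rule borel_measurable_quadratic_statistic[OF sizes \<phi>])
         (use less[OF p] null in \<open>auto intro!: measurable_component_singleton\<close>)
    show "?act g \<in> ?N \<rightarrow>\<^sub>M ?N" "distr ?N ?N (?act g) = ?N" if "g \<in> ?G" for g
      using that measurable_bin_map[OF n] distr_PiM_bin_map[OF prob_P n] by auto
    show "?F (?act g d) p = ?F d (g \<circ> p)" if "p permutes {..<s}" for g p d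
      by (rule quadratic_statistic_cong[OF sizes])
         (use less[OF that] in \<open>auto simp: bin_map_comp[OF n]\<close>)
    show "homogeneity_statistics ?T n1 n2 s Y Z \<pi> 0 \<omega> = ?F (\<lambda>i\<in>{..<?n}. pooled n1 Y Z i \<omega>) id" for \<omega>
      unfolding homogeneity_statistics_def if_P[OF refl]
      by (rule quadratic_statistic_cong[OF sizes]) (auto simp: bin_map_id pooled_def)
    show "homogeneity_statistics ?T n1 n2 s Y Z \<pi> b \<omega> = ?F (\<lambda>i\<in>{..<?n}. pooled n1 Y Z i \<omega>) (\<pi> b \<omega>)"
      if "b \<in> {1..B}" "\<omega> \<in> space M" for b \<omega>
    proof -
      have "homogeneity_statistics ?T n1 n2 s Y Z \<pi> b \<omega>
          = ?T (\<lambda>i. pooled n1 Y Z (bin_map ?n s (\<pi> b \<omega>) i) \<omega>) (\<lambda>j. pooled n1 Y Z (bin_map ?n s (\<pi> b \<omega>) (n1 + j)) \<omega>)"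
        using that by (simp add: homogeneity_statistics_def Let_def)
      also have "\<dots> = ?F (\<lambda>i\<in>{..<?n}. pooled n1 Y Z i \<omega>) (\<pi> b \<omega>)"
        by (rule quadratic_statistic_cong[OF sizes]) (use less[OF draws_permute[OF that]] in auto)
      finally show ?thesis .
    qed
  qed auto
qed

section \<open>The independence test\<close>

lemma measurable_zip_PiM:
  "(\<lambda>(y, z). \<lambda>i\<in>I. (y i, z i)) \<in> Pi\<^sub>M I (\<lambda>_. P) \<Otimes>\<^sub>M Pi\<^sub>M I (\<lambda>_. Q) \<rightarrow>\<^sub>M Pi\<^sub>M I (\<lambda>_. P \<Otimes>\<^sub>M Q)"
  unfolding case_prod_unfold
  by (intro measurable_restrict measurable_Pair
        measurable_compose[OF measurable_fst measurable_component_singleton]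
        measurable_compose[OF measurable_snd measurable_component_singleton])

text \<open>
  On a product of sets \<open>A i\<close>, Fubini's theorem reduces both sides to the product over \<open>i\<close> of the
  integrals of the \<open>Q\<close>-measures of the sections of \<open>A i\<close>.
\<close>

lemma distr_zip_PiM:
  assumes "finite I" and P: "prob_space P" and Q: "prob_space Q"
  shows "distr (Pi\<^sub>M I (\<lambda>_. P) \<Otimes>\<^sub>M Pi\<^sub>M I (\<lambda>_. Q)) (Pi\<^sub>M I (\<lambda>_. P \<Otimes>\<^sub>M Q)) (\<lambda>(y, z). \<lambda>i\<in>I. (y i, z i))
       = Pi\<^sub>M I (\<lambda>_. P \<Otimes>\<^sub>M Q)"
    (is "distr (?P \<Otimes>\<^sub>M ?Q) ?PQ ?zip = _")
proof -
  interpret P: prob_space P by fact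
  interpret Q: prob_space Q by fact
  interpret PQ: pair_prob_space P Q ..
  interpret prodP: product_prob_space "\<lambda>_. P" I ..
  interpret prodQ: product_prob_space "\<lambda>_. Q" I ..
  interpret prodPQ: product_prob_space "\<lambda>_. P \<Otimes>\<^sub>M Q" I ..
  have sigma_finite_Q: "sigma_finite_measure ?Q" by (intro prob_space_imp_sigma_finite prob_space_PiM Q)
  have zip: "?zip \<in> ?P \<Otimes>\<^sub>M ?Q \<rightarrow>\<^sub>M ?PQ"
    by (rule measurable_zip_PiM)
  show ?thesis
  proof (rule prodPQ.PiM_eqI[OF \<open>finite I\<close>])
    fix A assume A: "\<And>i. i \<in> I \<Longrightarrow> A i \<in> sets (P \<Otimes>\<^sub>M Q)"
    let ?X = "?zip -` Pi\<^sub>E I A \<inter> space (?P \<Otimes>\<^sub>M ?Q)"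
    have PiE_A: "Pi\<^sub>E I A \<in> sets ?PQ"
      using A by (intro sets_PiM_I_finite \<open>finite I\<close>)
    have section_meas: "Pair u -` A i \<in> sets Q" if "i \<in> I" for u i
      using A[OF that] by (rule sets_Pair1)
    have "emeasure (distr (?P \<Otimes>\<^sub>M ?Q) ?PQ ?zip) (Pi\<^sub>E I A) = emeasure (?P \<Otimes>\<^sub>M ?Q) ?X"
      by (rule emeasure_distr[OF zip PiE_A])
    also have "\<dots> = (\<integral>\<^sup>+y. emeasure ?Q (Pair y -` ?X) \<partial>?P)"
      by (rule sigma_finite_measure.emeasure_pair_measure_alt[OF sigma_finite_Q]) (rule measurable_sets[OF zip PiE_A])
    also have "\<dots> = (\<integral>\<^sup>+y. (\<Prod>i\<in>I. emeasure Q (Pair (y i) -` A i)) \<partial>?P)"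
    proof (rule nn_integral_cong)
      fix y assume y: "y \<in> space ?P"
      have "z i \<in> space Q" if "i \<in> I" "(y i, z i) \<in> A i" for z i
        using sets.sets_into_space[OF A[OF that(1)]] that(2) by (auto simp: space_pair_measure)
      then have "Pair y -` ?X = Pi\<^sub>E I (\<lambda>i. Pair (y i) -` A i)"
        using y by (auto simp: space_pair_measure space_PiM PiE_iff)
      then show "emeasure ?Q (Pair y -` ?X) = (\<Prod>i\<in>I. emeasure Q (Pair (y i) -` A i))"
        using section_meas by (simp add: prodQ.emeasure_PiM[OF \<open>finite I\<close>])
    qed
    also have "\<dots> = (\<Prod>i\<in>I. \<integral>\<^sup>+u. emeasure Q (Pair u -` A i) \<partial>P)"
      by (rule prodP.product_nn_integral_prod[OF \<open>finite I\<close>]) (rule Q.measurable_emeasure_Pair[OF A])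
    also have "\<dots> = (\<Prod>i\<in>I. emeasure (P \<Otimes>\<^sub>M Q) (A i))"
      by (intro prod.cong refl Q.emeasure_pair_measure_alt[symmetric] A)
    finally show "emeasure (distr (?P \<Otimes>\<^sub>M ?Q) ?PQ ?zip) (Pi\<^sub>E I A) = (\<Prod>i\<in>I. emeasure (P \<Otimes>\<^sub>M Q) (A i))" .
  qed simp
qed

lemma measurable_bin_map_snd:
  assumes n: "0 < n" "s dvd n" and g: "g permutes {..<s}"
  shows "(\<lambda>d. \<lambda>i\<in>{..<n}. (fst (d i), snd (d (bin_map n s g i))))
         \<in> Pi\<^sub>M {..<n} (\<lambda>_. P \<Otimes>\<^sub>M Q) \<rightarrow>\<^sub>M Pi\<^sub>M {..<n} (\<lambda>_. P \<Otimes>\<^sub>M Q)"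
  using bin_map_less[OF n g]
  by (intro measurable_restrict measurable_Pair
        measurable_compose[OF measurable_component_singleton[where M="\<lambda>_. P \<Otimes>\<^sub>M Q"] measurable_fst]
        measurable_compose[OF measurable_component_singleton[where M="\<lambda>_. P \<Otimes>\<^sub>M Q"] measurable_snd]) auto

text \<open>
  Permuting only the second components leaves the law unchanged: after the sample of pairs is
  unzipped into two independent samples, this is a permutation of the entries of the second one.
\<close>

lemma distr_PiM_bin_map_snd:
  assumes P: "prob_space P" and Q: "prob_space Q" and n: "0 < n" "s dvd n" and g: "g permutes {..<s}"
  shows "distr (Pi\<^sub>M {..<n} (\<lambda>_. P \<Otimes>\<^sub>M Q)) (Pi\<^sub>M {..<n} (\<lambda>_. P \<Otimes>\<^sub>M Q))
           (\<lambda>d. \<lambda>i\<in>{..<n}. (fst (d i), snd (d (bin_map n s g i))))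
       = Pi\<^sub>M {..<n} (\<lambda>_. P \<Otimes>\<^sub>M Q)"
    (is "distr ?PQ ?PQ ?act = _")
proof -
  let ?P = "Pi\<^sub>M {..<n} (\<lambda>_. P)" and ?Q = "Pi\<^sub>M {..<n} (\<lambda>_. Q)"
  let ?zip = "\<lambda>(y, z). \<lambda>i\<in>{..<n}. (y i, z i)" and ?shuffle = "\<lambda>z. \<lambda>i\<in>{..<n}. z (bin_map n s g i)"
  interpret Q: prob_space ?Q by (intro prob_space_PiM Q)
  have zip: "?zip \<in> ?P \<Otimes>\<^sub>M ?Q \<rightarrow>\<^sub>M ?PQ"
    by (rule measurable_zip_PiM)
  note shuffle = measurable_bin_map[OF n g, of Q] and shuffle_law = distr_PiM_bin_map[OF Q n g]
  have "?PQ = distr (?P \<Otimes>\<^sub>M ?Q) ?PQ ?zip"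
    by (rule distr_zip_PiM[symmetric, OF _ P Q]) simp
  also have "?P \<Otimes>\<^sub>M ?Q = distr ?P ?P (\<lambda>y. y) \<Otimes>\<^sub>M distr ?Q ?Q ?shuffle"
    by (simp only: shuffle_law distr_id)
  also have "\<dots> = distr (?P \<Otimes>\<^sub>M ?Q) (?P \<Otimes>\<^sub>M ?Q) (\<lambda>(y, z). (y, ?shuffle z))"
    by (rule pair_measure_distr[OF measurable_ident shuffle, unfolded id_def])
       (simp only: shuffle_law Q.sigma_finite_measure_axioms)
  also have "distr \<dots> ?PQ ?zip = distr (?P \<Otimes>\<^sub>M ?Q) ?PQ (?zip \<circ> (\<lambda>(y, z). (y, ?shuffle z)))"
    by (rule distr_distr[OF zip]) (unfold case_prod_unfold, intro measurable_Pair measurable_fst measurable_compose[OF measurable_snd shuffle])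
  \<comment> \<open>Permuting the second sample and then zipping is the same as zipping and then permuting the second
    components.\<close>
  also have "\<dots> = distr (?P \<Otimes>\<^sub>M ?Q) ?PQ (?act \<circ> ?zip)"
    using bin_map_less[OF n g] by (intro distr_cong refl) (auto simp: fun_eq_iff)
  also have "\<dots> = distr (distr (?P \<Otimes>\<^sub>M ?Q) ?PQ ?zip) ?PQ ?act"
    by (rule distr_distr[symmetric, OF measurable_bin_map_snd[OF n g] zip])
  also have "\<dots> = distr ?PQ ?PQ ?act"
    by (subst distr_zip_PiM[OF _ P Q]) simp_all
  finally show ?thesis by simp
qed


text \<open>
  The swaps of the pairs \<open>i\<close> and \<open>i + s / 2\<close> are commuting involutions, so that composition adds the
  coin flips modulo \<open>2\<close>. Thus the wild bootstrap permutations form a group.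
\<close>

lemma wild_swap_comp:
  assumes "even s"
  shows "wild_swap s c \<circ> wild_swap s c' = wild_swap s (\<lambda>i. c i \<noteq> c' i)"
proof
  fix i
  obtain k where "s = 2 * k" using assms by blast
  then show "(wild_swap s c \<circ> wild_swap s c') i = wild_swap s (\<lambda>i. c i \<noteq> c' i) i"
    by (cases "i < k"; cases "i < 2 * k") (auto simp: wild_swap_def)
qed

lemma wild_swap_permutes:
  assumes "even s"
  shows "wild_swap s c permutes {..<s}"
proof -
  have "wild_swap s c (wild_swap s c i) = i" for i
    using fun_cong[OF wild_swap_comp[OF assms, of c c], of i] by (simp add: wild_swap_def)
  then have "\<exists>!i. wild_swap s c i = j" for j by metis
  moreover have "wild_swap s c i = i" if "i \<notin> {..<s}" for i
    using that by (auto simp: wild_swap_def)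
  ultimately show ?thesis by (simp add: permutes_def)
qed

text \<open>
  Fair coins make all flip patterns on the first half of the bins equally likely, and a wild
  bootstrap permutation determines its flip pattern.
\<close>

lemma wild_bootstrap_pmf_eq:
  "wild_bootstrap_pmf s = pmf_of_set (wild_swap s ` PiE_dflt {..<s div 2} False (\<lambda>_. UNIV))"
proof -
  let ?C = "PiE_dflt {..<s div 2} False (\<lambda>_. UNIV)"
  have "c = c'" if c: "c \<in> ?C" "c' \<in> ?C" and eq: "wild_swap s c = wild_swap s c'" for c c'
  proof
    fix i
    show "c i = c' i"
    proof (cases "i < s div 2")
      case True
      then show ?thesis
        using fun_cong[OF eq, of i] by (auto simp: wild_swap_def split: if_splits)
    next
      case False
      then show ?thesis using c by (auto simp: PiE_dflt_def)
    qed
  qed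
  then have "inj_on (wild_swap s) ?C" by (auto intro: inj_onI)
  moreover have "?C \<noteq> {}"
    by (auto simp: PiE_dflt_def)
  moreover have "finite ?C"
    by (intro finite_PiE_dflt) auto
  ultimately show ?thesis
    by (simp add: wild_bootstrap_pmf_def bernoulli_pmf_half_conv_pmf_of_set Pi_pmf_of_set map_pmf_of_set_inj)
qed

lemma independence_V_statistic_cong:
  assumes "\<And>i. i < n \<Longrightarrow> y i = y' i" "\<And>i. i < n \<Longrightarrow> z i = z' i"
  shows "independence_V_statistic gY gZ n y z = independence_V_statistic gY gZ n y' z'"
  unfolding independence_V_statistic_def
  by (intro arg_cong[where f="\<lambda>x. 1 / real n ^ 4 * x"] sum.cong refl) (auto simp: assms)

lemma borel_measurable_independence_V_statistic:
  assumes g: "case_prod gY \<in> borel_measurable (P \<Otimes>\<^sub>M P)" "case_prod gZ \<in> borel_measurable (Q \<Otimes>\<^sub>M Q)"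
    and y: "\<And>i. i < n \<Longrightarrow> (\<lambda>d. y d i) \<in> N \<rightarrow>\<^sub>M P" and z: "\<And>i. i < n \<Longrightarrow> (\<lambda>d. z d i) \<in> N \<rightarrow>\<^sub>M Q"
  shows "(\<lambda>d. independence_V_statistic gY gZ n (y d) (z d)) \<in> borel_measurable N"
proof -
  have [measurable]: "(\<lambda>d. gY (y d i) (y d j)) \<in> borel_measurable N" if "i < n" "j < n" for i j
    using measurable_compose[OF measurable_Pair[OF y[OF that(1)] y[OF that(2)]] g(1)] by simp
  have [measurable]: "(\<lambda>d. gZ (z d i) (z d j)) \<in> borel_measurable N" if "i < n" "j < n" for i j
    using measurable_compose[OF measurable_Pair[OF z[OF that(1)] z[OF that(2)]] g(2)] by simp
  show ?thesis
    unfolding independence_V_statistic_def case_prod_unfold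
    by (intro borel_measurable_times borel_measurable_const borel_measurable_sum) auto
qed

text \<open>
  The group of wild bootstrap permutations rearranges the bins of the \<open>Z\<close> sample, which is i.i.d. and
  independent of the \<open>Y\<close> sample under the null hypothesis.
\<close>

theorem (in cheap_independence_test) independence_rejection_probability:
  assumes level: "0 < \<alpha>" "\<alpha> < 1"
    and g: "case_prod gY \<in> borel_measurable (P \<Otimes>\<^sub>M P)" "case_prod gZ \<in> borel_measurable (Q \<Otimes>\<^sub>M Q)"
    and null: "J = P \<Otimes>\<^sub>M Q"
  shows "rejection_probability M \<alpha> B
    (independence_statistics (independence_V_statistic gY gZ n) n s Y Z \<pi>) \<tau> = \<alpha>"
proof -
  let ?N = "Pi\<^sub>M {..<n} (\<lambda>_. J)" and ?C = "PiE_dflt {..<s div 2} False (\<lambda>_. UNIV)"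
  let ?V = "independence_V_statistic gY gZ n" and ?D = "\<lambda>\<omega>. \<lambda>i\<in>{..<n}. (Y i \<omega>, Z i \<omega>)"
  let ?F = "\<lambda>d p. ?V (\<lambda>i. fst (d i)) (\<lambda>i. snd (d (bin_map n s p i)))"
  let ?act = "\<lambda>k d. \<lambda>i\<in>{..<n}. (fst (d i), snd (d (bin_map n s k i)))"
  note n = size bins(2)
  note less = bin_map_less[OF n]
  have fst: "fst \<in> J \<rightarrow>\<^sub>M P" and snd: "snd \<in> J \<rightarrow>\<^sub>M Q" by (simp_all add: null)
  have prob_P: "prob_space P" and prob_Q: "prob_space Q"
    using prob_space.prob_space_distr[OF prob_J fst] prob_space.prob_space_distr[OF prob_J snd]
    by (simp_all add: marginals)
  have data: "distr M ?N ?D = ?N"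
  proof -
    have "distr M ?N ?D = Pi\<^sub>M {..<n} (\<lambda>i. distr M J (\<lambda>\<omega>. (Y i \<omega>, Z i \<omega>)))"
    proof (subst indep_vars_iff_distr_eq_PiM'[symmetric])
      show "random_variable J (\<lambda>\<omega>. (Y i \<omega>, Z i \<omega>))" if "i \<in> {..<n}" for i
        using data_indep that unfolding indep_vars_def by blast
    qed (use n data_indep in auto)
    also have "\<dots> = ?N" by (intro PiM_cong refl data_law) simp
    finally show ?thesis .
  qed
  show ?thesis
  proof (rule rejection_probability_eq_level[where F="?F" and act="?act", OF level wild_bootstrap_pmf_eq])
    show "wild_swap s ` ?C \<noteq> {}"
      by (auto simp: PiE_dflt_def)
    show "k permutes {..<s}" if "k \<in> wild_swap s ` ?C" for k
      using that wild_swap_permutes[OF bins(1)] by auto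
    then show "?act k \<in> ?N \<rightarrow>\<^sub>M ?N" "distr ?N ?N (?act k) = ?N" if "k \<in> wild_swap s ` ?C" for k
      using that measurable_bin_map_snd[OF n] distr_PiM_bin_map_snd[OF prob_P prob_Q n] by (auto simp: null)
    show "k \<circ> k' \<in> wild_swap s ` ?C" if k: "k \<in> wild_swap s ` ?C" "k' \<in> wild_swap s ` ?C" for k k'
    proof -
      obtain c c' where c: "c \<in> ?C" "c' \<in> ?C" "k = wild_swap s c" "k' = wild_swap s c'"
        using k by blast
      then have "(\<lambda>i. c i \<noteq> c' i) \<in> ?C" by (auto simp: PiE_dflt_def)
      then show ?thesis using c(3,4) by (auto simp: wild_swap_comp[OF bins(1)])
    qed
    show "distr M ?N ?D = ?N" by (rule data)
    show "(\<lambda>d. ?F d p) \<in> borel_measurable ?N" if p: "p permutes {..<s}" for p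
    proof (rule borel_measurable_independence_V_statistic[OF g])
      fix i assume "i < n"
      then show "(\<lambda>d. fst (d i)) \<in> ?N \<rightarrow>\<^sub>M P"
        by (intro measurable_compose[OF measurable_component_singleton[where M="\<lambda>_. J"] fst]) simp
      show "(\<lambda>d. snd (d (bin_map n s p i))) \<in> ?N \<rightarrow>\<^sub>M Q"
        using less[OF p \<open>i < n\<close>]
        by (intro measurable_compose[OF measurable_component_singleton[where M="\<lambda>_. J"] snd]) simp
    qed
    show "?F (?act k d) p = ?F d (k \<circ> p)" if "p permutes {..<s}" for k p d
      by (rule independence_V_statistic_cong)
         (use less[OF that] in \<open>auto simp: bin_map_comp[OF n]\<close>)
    show "independence_statistics ?V n s Y Z \<pi> 0 \<omega> = ?F (?D \<omega>) id" for \<omega>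
      unfolding independence_statistics_def if_P[OF refl]
      by (rule independence_V_statistic_cong) (auto simp: bin_map_id)
    show "independence_statistics ?V n s Y Z \<pi> b \<omega> = ?F (?D \<omega>) (\<pi> b \<omega>)"
      if "b \<in> {1..B}" "\<omega> \<in> space M" for b \<omega>
    proof -
      have "independence_statistics ?V n s Y Z \<pi> b \<omega>
          = ?V (\<lambda>i. Y i \<omega>) (\<lambda>i. Z (bin_map n s (\<pi> b \<omega>) i) \<omega>)"
        using that by (simp add: independence_statistics_def)
      also have "\<dots> = ?F (?D \<omega>) (\<pi> b \<omega>)"
        by (rule independence_V_statistic_cong) (use less[OF draws_permute[OF that]] in auto)
      finally show ?thesis .
    qed
  qed
qed

section \<open>Exact level of both tests\<close>

theorem proposition1:
  fixes \<alpha> :: real and B :: nat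
  assumes "0 < \<alpha>" and "\<alpha> < 1"
  shows
    "(\<forall>(M :: 'w measure) (P :: 'a measure) (Q :: 'a measure) n1 n2 Y Z s \<pi> \<tau> \<phi>1 \<phi>12 \<phi>2.
        cheap_homogeneity_test M P Q n1 n2 Y Z s B \<pi> \<tau> \<longrightarrow>
        \<phi>1 \<in> borel_measurable (P \<Otimes>\<^sub>M P) \<longrightarrow>
        \<phi>12 \<in> borel_measurable (P \<Otimes>\<^sub>M Q) \<longrightarrow>
        \<phi>2 \<in> borel_measurable (Q \<Otimes>\<^sub>M Q) \<longrightarrow>
        P = Q \<longrightarrow>
        rejection_probability M \<alpha> B
          (homogeneity_statistics (quadratic_statistic \<phi>1 \<phi>12 \<phi>2 n1 n2) n1 n2 s Y Z \<pi>) \<tau> = \<alpha>)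
     \<and>
     (\<forall>(M :: 'v measure) (J :: ('b \<times> 'c) measure) P Q n Y Z s \<pi> \<tau> gY gZ.
        cheap_independence_test M J P Q n Y Z s B \<pi> \<tau> \<longrightarrow>
        case_prod gY \<in> borel_measurable (P \<Otimes>\<^sub>M P) \<longrightarrow>
        case_prod gZ \<in> borel_measurable (Q \<Otimes>\<^sub>M Q) \<longrightarrow>
        (\<forall>y\<in>space P. \<forall>y'\<in>space P. gY y y' = gY y' y) \<longrightarrow>
        (\<forall>z\<in>space Q. \<forall>z'\<in>space Q. gZ z z' = gZ z' z) \<longrightarrow>
        J = P \<Otimes>\<^sub>M Q \<longrightarrow>
        rejection_probability M \<alpha> B
          (independence_statistics (independence_V_statistic gY gZ n) n s Y Z \<pi>) \<tau> = \<alpha>)"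
proof (intro conjI allI impI)
  fix M :: "'w measure" and P Q :: "'a measure" and n1 n2 Y Z s \<pi> \<tau>
    and \<phi>1 \<phi>12 \<phi>2 :: "'a \<times> 'a \<Rightarrow> real"
  assume test: "cheap_homogeneity_test M P Q n1 n2 Y Z s B \<pi> \<tau>"
    and "\<phi>1 \<in> borel_measurable (P \<Otimes>\<^sub>M P)" "\<phi>12 \<in> borel_measurable (P \<Otimes>\<^sub>M Q)"
      "\<phi>2 \<in> borel_measurable (Q \<Otimes>\<^sub>M Q)" "P = Q"
  then show "rejection_probability M \<alpha> B
      (homogeneity_statistics (quadratic_statistic \<phi>1 \<phi>12 \<phi>2 n1 n2) n1 n2 s Y Z \<pi>) \<tau> = \<alpha>"
    by (intro cheap_homogeneity_test.homogeneity_rejection_probability[OF test assms])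
next
  fix M :: "'v measure" and J :: "('b \<times> 'c) measure" and P Q n Y Z s \<pi> \<tau>
    and gY :: "'b \<Rightarrow> 'b \<Rightarrow> real" and gZ :: "'c \<Rightarrow> 'c \<Rightarrow> real"
  assume test: "cheap_independence_test M J P Q n Y Z s B \<pi> \<tau>"
    and "case_prod gY \<in> borel_measurable (P \<Otimes>\<^sub>M P)" "case_prod gZ \<in> borel_measurable (Q \<Otimes>\<^sub>M Q)"
      "J = P \<Otimes>\<^sub>M Q"
  then show "rejection_probability M \<alpha> B
      (independence_statistics (independence_V_statistic gY gZ n) n s Y Z \<pi>) \<tau> = \<alpha>"
    by (intro cheap_independence_test.independence_rejection_probability[OF test assms])
qed

end
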